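(* A (generic) fundamental point-circle complex $(\mathsf p,\mathsf c)$ is uniquely determined by constrained Cauchy data $\mathsf p(A_2^{-2}),\ \mathsf c(A_2^{-1}),\ \mathsf p(A_2^0),\ \mathsf c(A_2^1),\ \mathsf p(A_2^2)$ which respect incidence, i.e. by points attached to the vertices of $A_2^{-2},A_2^0,A_2^2$ and circles attached to the vertices of $A_2^{-1},A_2^1$ such that a point and a circle attached to neighbouring vertices of $\mathbb Z^3$ are incident. Hence, if points $\mathsf p(A_2^0)$ are chosen in such a manner that the points $\mathsf p(A_2^{-2})$ and $\mathsf p(A_2^2)$ exist, then an associated fundamental point-circle complex exists and is unique. Here, existence of $\mathsf p(A_2^{\pm2})$ means the following: for $v\in A_2^{1}$ let $\mathsf c(v)$ be the circle through $\mathsf p(v-e_1),\mathsf p(v-e_2),\mathsf p(v-e_3)$, and for $v\in A_2^{-1}$ let $\mathsf c(v)$ be the circle through $\mathsf p(v+e_1),\mathsf p(v+e_2),\mathsf p(v+e_3)$; then for every $u\in A_2^2$ the three circles $\mathsf c(u-e_1),\mathsf c(u-e_2),\mathsf c(u-e_3)$ meet in a point $\mathsf p(u)$, and for every $u\in A_2^{-2}$ the three circles $\mathsf c(u+e_1),\mathsf c(u+e_2),\mathsf c(u+e_3)$ meet in a point $\mathsf p(u)$.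
   Context: $e_1,e_2,e_3$ is the standard basis of $\mathbb Z^3$. $A_2^k=\{(n_1,n_2,n_3)\in\mathbb Z^3:n_1+n_2+n_3=k\}$. A fundamental point-circle complex is a pair of maps $\mathsf p$ from the even sublattice $\{n_1+n_2+n_3\text{ even}\}$ to points of $\mathbb R^2$ and $\mathsf c$ from the odd sublattice $\{n_1+n_2+n_3\text{ odd}\}$ to (non-oriented) circles of $\mathbb R^2$ such that the point and the circle attached to the two endpoints of any edge of $\mathbb Z^3$ are incident. (As is usual in Möbius geometry, circles may be lines and points may be at infinity.) All configurations are assumed to be generic: the points and circles that are attached to vertices of a common $2\times2\times2$ block of elementary cubes and that occur in the construction are pairwise distinct; in particular the three points determining a circle are distinct, and the point at a vertex obtained as the common point of circles is different from the pairwise intersection points of these circles already attached to other vertices. *)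

theory Defs
  imports "HOL-Analysis.Analysis"
begin

section \<open>The Moebius plane\<close>

text \<open>
  The plane with one point at infinity: \<open>Some x\<close> is a finite point and \<open>None\<close> is the point at
  infinity, as in the library's \<open>Alexandroff_compactification\<close>. A non-oriented circle is
  identified with the set of points incident with it, so incidence is membership. Lines are the
  circles through infinity.
\<close>

type_synonym mpoint = "(real^2) option"

definition mcircles :: "mpoint set set" where
  "mcircles = {Some ` sphere a r | a r. r > 0}
            \<union> {insert None (Some ` (affine hull {a, b})) | a b. a \<noteq> b}"

text \<open>Only meaningful if \<open>S\<close> lies on exactly one circle, e.g. for three distinct points.\<close>

definition circle_through :: "mpoint set \<Rightarrow> mpoint set" where
  "circle_through S = (THE C. C \<in> mcircles \<and> S \<subseteq> C)"


section \<open>The cubic lattice\<close>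

abbreviation std_basis :: "3 \<Rightarrow> int^3" where
  "std_basis i \<equiv> axis i 1"

definition height :: "int^3 \<Rightarrow> int" where
  "height n = (\<Sum>i\<in>UNIV. n $ i)"

definition even_lattice :: "(int^3) set" where
  "even_lattice = {n. even (height n)}"

definition odd_lattice :: "(int^3) set" where
  "odd_lattice = {n. odd (height n)}"

definition A2 :: "int \<Rightarrow> (int^3) set" where
  "A2 k = {n. height n = k}"

text \<open>The union of the layers \<open>A2 k\<close> with \<open>a \<le> k \<le> b\<close>.\<close>

definition slab :: "int \<Rightarrow> int \<Rightarrow> (int^3) set" where
  "slab a b = (\<Union>k\<in>{a..b}. A2 k)"

text \<open>The 27 vertices of a \<open>2 \<times> 2 \<times> 2\<close> block of elementary cubes.\<close>

definition block :: "int^3 \<Rightarrow> (int^3) set" where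
  "block w = {n. \<forall>i. w $ i \<le> n $ i \<and> n $ i \<le> w $ i + 2}"


section \<open>Point-circle complexes\<close>

text \<open>
  Points and circles on the vertices in a region \<open>D\<close> which respect incidence along all edges of
  the lattice with both endpoints in \<open>D\<close>. The maps are extensional (\<open>undefined\<close> off the even,
  respectively odd, vertices of \<open>D\<close>), so equality of maps is equality on their domains.
\<close>

definition point_circle_complex_on ::
  "(int^3) set \<Rightarrow> (int^3 \<Rightarrow> mpoint) \<Rightarrow> (int^3 \<Rightarrow> mpoint set) \<Rightarrow> bool" where
  "point_circle_complex_on D p c \<longleftrightarrow>
     p \<in> D \<inter> even_lattice \<rightarrow>\<^sub>E UNIV \<and>
     c \<in> D \<inter> odd_lattice \<rightarrow>\<^sub>E mcircles \<and>
     (\<forall>u \<in> D \<inter> even_lattice. \<forall>v \<in> D \<inter> odd_lattice.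
        (\<exists>i. v = u + std_basis i \<or> u = v + std_basis i) \<longrightarrow> p u \<in> c v)"

definition fundamental_point_circle_complex ::
  "(int^3 \<Rightarrow> mpoint) \<Rightarrow> (int^3 \<Rightarrow> mpoint set) \<Rightarrow> bool" where
  "fundamental_point_circle_complex p c \<longleftrightarrow> point_circle_complex_on UNIV p c"

definition generic_on ::
  "(int^3) set \<Rightarrow> (int^3 \<Rightarrow> mpoint) \<Rightarrow> (int^3 \<Rightarrow> mpoint set) \<Rightarrow> bool" where
  "generic_on D p c \<longleftrightarrow>
     (\<forall>w. inj_on p (block w \<inter> D \<inter> even_lattice) \<and> inj_on c (block w \<inter> D \<inter> odd_lattice))"

definition agree_on ::
  "(int^3) set \<Rightarrow> (int^3 \<Rightarrow> mpoint) \<Rightarrow> (int^3 \<Rightarrow> mpoint set) \<Rightarrow>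
   (int^3 \<Rightarrow> mpoint) \<Rightarrow> (int^3 \<Rightarrow> mpoint set) \<Rightarrow> bool" where
  "agree_on D p c p' c' \<longleftrightarrow>
     (\<forall>u \<in> D \<inter> even_lattice. p u = p' u) \<and> (\<forall>v \<in> D \<inter> odd_lattice. c v = c' v)"

text \<open>
  The standing genericity assumption for data \<open>(p0, c0)\<close> on \<open>D\<close>: no coincidences occur at any
  stage of the layer-by-layer construction, that is, whenever the data have been continued to the
  layers \<open>a, \<dots>, b\<close> with incidence respected, the continuation obtained is generic. It does not
  assert that a continuation exists. Since \<open>(a, b)\<close> may be the range of the data themselves, these
  are generic in particular. For \<open>D = A2 0\<close>, which has no odd vertices, \<open>c0\<close> plays no role.
\<close>

definition generic_data ::
  "(int^3) set \<Rightarrow> (int^3 \<Rightarrow> mpoint) \<Rightarrow> (int^3 \<Rightarrow> mpoint set) \<Rightarrow> bool" where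
  "generic_data D p0 c0 \<longleftrightarrow>
     (\<forall>a b p c. D \<subseteq> slab a b \<and> point_circle_complex_on (slab a b) p c \<and> agree_on D p c p0 c0
        \<longrightarrow> generic_on (slab a b) p c)"

end

theory Submission
  imports Defs
begin

text \<open>
  A layer of circles is determined by the three points below each vertex. For a layer of points one
  needs that the three circles below a vertex \<open>u\<close> concur. The \<open>2 \<times> 2 \<times> 2\<close> block with top vertex \<open>u\<close>
  carries an octahedron: its six face centres are points of the circle \<open>K\<close> at the centre of the block,
  its twelve edge midpoints are circles through pairs of these points, and its eight corners are points
  common to the three circles along a face of the octahedron. Three circles along a face concur off
  \<open>K\<close> iff the sum of their directed angles with \<open>K\<close> vanishes modulo \<open>\<pi>\<close>. The alternating sum of these
  conditions over the eight faces vanishes identically, so seven concurrences imply the eighth.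
\<close>

section \<open>Circles and inversions\<close>

text \<open>The block with top vertex \<open>u\<close> meets seven consecutive layers, and the seven
  known faces use all six layers below \<open>u\<close>. This explains the extent of the Cauchy
  data: layers -2 to 2, together with the circles of layer 3, which always exist, are exactly the
  six layers that force the points of layer 4. For the points of layers 2 and -2 no such block is at
  hand, so there concurrence has to be assumed. Angles modulo \<pi> appear only through their
  cotangents. A point of \<open>K\<close> other than the six octahedron vertices is sent to
  infinity, so that \<open>K\<close> becomes a line while every edge circle stays an ordinary
  circle; as it differs from \<open>K\<close> and meets it in two points, its cotangent is finite.
  The fraction (t + i) / (t - i) turns the sum of angles into a product, and the eight face
  conditions then cancel by commutativity alone. Genericity serves three purposes: it keeps the
  known face points off \<open>K\<close>, makes the three points below a circle vertex distinct, and
  leaves no choice between the two intersection points of two circles. Downward continuation is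
  upward continuation after the reflection of the lattice in the origin.\<close>

definition circ :: "real \<Rightarrow> real \<Rightarrow> real \<Rightarrow> real \<Rightarrow> mpoint set" where
  "circ \<alpha> \<beta> \<gamma> \<delta> = {P. case P of None \<Rightarrow> \<alpha> = 0
     | Some p \<Rightarrow> \<alpha> * ((p$1)\<^sup>2 + (p$2)\<^sup>2) + \<beta> * p$1 + \<gamma> * p$2 + \<delta> = 0}"

lemma None_in_circ [simp]: "None \<in> circ \<alpha> \<beta> \<gamma> \<delta> \<longleftrightarrow> \<alpha> = 0"
  by (simp add: circ_def)

lemma Some_in_circ [simp]:
  "Some p \<in> circ \<alpha> \<beta> \<gamma> \<delta> \<longleftrightarrow> \<alpha> * ((p$1)\<^sup>2 + (p$2)\<^sup>2) + \<beta> * p$1 + \<gamma> * p$2 + \<delta> = 0"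
  by (simp add: circ_def)

lemma set_eq_option_iff:
  "A = B \<longleftrightarrow> (None \<in> A \<longleftrightarrow> None \<in> B) \<and> (\<forall>p. Some p \<in> A \<longleftrightarrow> Some p \<in> B)"
  by (auto simp: set_eq_iff split_option_all)

lemma norm_vec2_squared: "(norm (p::real^2))\<^sup>2 = (p$1)\<^sup>2 + (p$2)\<^sup>2"
  unfolding power2_norm_eq_inner by (simp add: inner_vec_def sum_2 power2_eq_square)

lemma line_eq_circ:
  fixes a b :: "real^2"
  assumes "a \<noteq> b"
  shows "insert None (Some ` (affine hull {a, b})) =
    circ 0 (b$2 - a$2) (a$1 - b$1) (a$2 * b$1 - a$1 * b$2)"
proof -
  have "p \<in> affine hull {a, b} \<longleftrightarrow>
      (b$2 - a$2) * p$1 + (a$1 - b$1) * p$2 + (a$2 * b$1 - a$1 * b$2) = 0" (is "_ \<longleftrightarrow> ?E") for p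
  proof
    assume "p \<in> affine hull {a, b}"
    then obtain u v where p: "p = u *\<^sub>R a + v *\<^sub>R b" and "u + v = 1"
      by (auto simp: affine_hull_2)
    then have "u = 1 - v" by simp
    then have "p$1 = (1 - v) * a$1 + v * b$1" "p$2 = (1 - v) * a$2 + v * b$2"
      using p by simp_all
    then show ?E by algebra
  next
    assume E: ?E
    \<comment> \<open>\<open>M / N\<close> is the parameter of the orthogonal projection of
      \<open>p\<close> onto the line through \<open>a\<close> and \<open>b\<close>; the equation
      says that \<open>p\<close> is its own projection.\<close>
    define N where "N = (b$1 - a$1)\<^sup>2 + (b$2 - a$2)\<^sup>2"
    define M where "M = (b$1 - a$1) * (p$1 - a$1) + (b$2 - a$2) * (p$2 - a$2)"
    have "N \<noteq> 0"
      using assms by (auto simp: N_def vec_eq_iff forall_2)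
    moreover have "N * p$1 = (N - M) * a$1 + M * b$1" "N * p$2 = (N - M) * a$2 + M * b$2"
      using E unfolding N_def M_def by algebra+
    ultimately have "p = (1 - M / N) *\<^sub>R a + (M / N) *\<^sub>R b"
      by (simp add: vec_eq_iff forall_2 field_simps)
    then show "p \<in> affine hull {a, b}"
      unfolding affine_hull_2 mem_Collect_eq
      by (intro exI[of _ "1 - M / N"] exI[of _ "M / N"]) auto
  qed
  then show ?thesis by (simp add: set_eq_option_iff image_iff)
qed

lemma sphere_eq_circ:
  fixes a :: "real^2"
  assumes "r > 0"
  shows "Some ` sphere a r = circ 1 (- 2 * a$1) (- 2 * a$2) ((a$1)\<^sup>2 + (a$2)\<^sup>2 - r\<^sup>2)"
proof -
  have "p \<in> sphere a r \<longleftrightarrow> 1 * ((p$1)\<^sup>2 + (p$2)\<^sup>2) + (- 2 * a$1) * p$1 + (- 2 * a$2) * p$2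
      + ((a$1)\<^sup>2 + (a$2)\<^sup>2 - r\<^sup>2) = 0" (is "_ \<longleftrightarrow> ?E = 0") for p
  proof -
    have "p \<in> sphere a r \<longleftrightarrow> (norm (p - a))\<^sup>2 = r\<^sup>2"
      using assms by (simp add: dist_norm norm_minus_commute)
    moreover have "(norm (p - a))\<^sup>2 - r\<^sup>2 = ?E"
      unfolding norm_vec2_squared by (simp add: power2_eq_square algebra_simps)
    ultimately show ?thesis by (metis eq_iff_diff_eq_0)
  qed
  then show ?thesis
    unfolding set_eq_option_iff None_in_circ Some_in_circ by (simp add: image_iff)
qed

text \<open>The discriminant is 4 \<alpha>^2 r^2 for a circle of radius r and the squared length of
  the normal for a line. Its positivity excludes empty, one-point and degenerate loci, and later
  arguments can treat lines and proper circles by one equation.\<close>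

lemma mcircles_eq_circ:
  "mcircles = {circ \<alpha> \<beta> \<gamma> \<delta> | \<alpha> \<beta> \<gamma> \<delta>. \<beta>\<^sup>2 + \<gamma>\<^sup>2 > 4 * \<alpha> * \<delta>}" (is "_ = ?R")
proof (intro equalityI subsetI)
  fix C assume "C \<in> mcircles"
  then consider a r where "r > 0" "C = Some ` sphere a r"
    | a b where "a \<noteq> b" "C = insert None (Some ` (affine hull {a, b}))"
    by (auto simp: mcircles_def)
  then show "C \<in> ?R"
  proof cases
    case 1
    have "(- 2 * a$1)\<^sup>2 + (- 2 * a$2)\<^sup>2 > 4 * 1 * ((a$1)\<^sup>2 + (a$2)\<^sup>2 - r\<^sup>2)"
      using 1 by (simp add: power2_eq_square)
    then show ?thesis using 1 sphere_eq_circ by blast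
  next
    case 2
    have "(b$2 - a$2)\<^sup>2 + (a$1 - b$1)\<^sup>2 > 4 * 0 * (a$2 * b$1 - a$1 * b$2)"
      using 2 by (auto simp: vec_eq_iff forall_2 sum_power2_gt_zero_iff)
    then show ?thesis using 2 line_eq_circ by blast
  qed
next
  fix C assume "C \<in> ?R"
  then obtain \<alpha> \<beta> \<gamma> \<delta> where C: "C = circ \<alpha> \<beta> \<gamma> \<delta>" and D: "\<beta>\<^sup>2 + \<gamma>\<^sup>2 > 4 * \<alpha> * \<delta>"
    by blast
  show "C \<in> mcircles"
  proof (cases "\<alpha> = 0")
    case True
    define N where "N = \<beta>\<^sup>2 + \<gamma>\<^sup>2"
    \<comment> \<open>\<open>a\<close> is the foot of the perpendicular from the origin to the line,
      and \<open>b\<close> is \<open>a\<close> moved along the direction (-\<gamma>, \<beta>), so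
      the coefficients of \<open>line_eq_circ\<close> come out without a scaling factor.\<close>
    define a b :: "real^2" where "a = vector [- \<delta> * \<beta> / N, - \<delta> * \<gamma> / N]"
      and "b = vector [- \<delta> * \<beta> / N - \<gamma>, - \<delta> * \<gamma> / N + \<beta>]"
    have N: "N > 0" using D True by (simp add: N_def)
    then have "a \<noteq> b"
      by (auto simp: a_def b_def vec_eq_iff forall_2 N_def)
    moreover have "a$2 * b$1 - a$1 * b$2 = \<delta>"
    proof -
      have "a$2 * b$1 - a$1 * b$2 = \<delta> * (\<beta>\<^sup>2 + \<gamma>\<^sup>2) / N"
        using N by (simp add: a_def b_def divide_simps) (simp add: power2_eq_square algebra_simps)
      then show ?thesis unfolding N_def[symmetric] using N by simp
    qed
    then have "C = circ 0 (b$2 - a$2) (a$1 - b$1) (a$2 * b$1 - a$1 * b$2)"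
      using C True by (simp add: a_def b_def)
    ultimately show ?thesis
      unfolding mcircles_def using line_eq_circ by blast
  next
    case False
    define a :: "real^2" where "a = vector [- \<beta> / (2 * \<alpha>), - \<gamma> / (2 * \<alpha>)]"
    define r where "r = sqrt ((\<beta>\<^sup>2 + \<gamma>\<^sup>2 - 4 * \<alpha> * \<delta>) / (4 * \<alpha>\<^sup>2))"
    have r: "r > 0" "r\<^sup>2 = (\<beta>\<^sup>2 + \<gamma>\<^sup>2 - 4 * \<alpha> * \<delta>) / (4 * \<alpha>\<^sup>2)"
      using D False by (auto simp: r_def)
    have "C = circ 1 (- 2 * a$1) (- 2 * a$2) ((a$1)\<^sup>2 + (a$2)\<^sup>2 - r\<^sup>2)"
    proof -
      have "- 2 * a$1 = \<beta> / \<alpha>" "- 2 * a$2 = \<gamma> / \<alpha>" by (auto simp: a_def)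
      moreover have "(a$1)\<^sup>2 + (a$2)\<^sup>2 - r\<^sup>2 = \<delta> / \<alpha>"
        using False unfolding r(2) by (simp add: a_def field_simps power2_eq_square)
      moreover have "circ 1 (\<beta> / \<alpha>) (\<gamma> / \<alpha>) (\<delta> / \<alpha>) = C"
      proof -
        have "1 * s + \<beta> / \<alpha> * x + \<gamma> / \<alpha> * y + \<delta> / \<alpha> = (\<alpha> * s + \<beta> * x + \<gamma> * y + \<delta>) / \<alpha>" for s x y
          using False by (simp add: add_divide_distrib)
        then show ?thesis
          using False unfolding C set_eq_option_iff None_in_circ Some_in_circ by simp
      qed
      ultimately show ?thesis by simp
    qed
    then show ?thesis
      unfolding mcircles_def using r(1) sphere_eq_circ by blast
  qed
qed

lemma mcirclesE:
  assumes "C \<in> mcircles"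
  obtains \<alpha> \<beta> \<gamma> \<delta> where "C = circ \<alpha> \<beta> \<gamma> \<delta>" "\<beta>\<^sup>2 + \<gamma>\<^sup>2 > 4 * \<alpha> * \<delta>"
  using assms unfolding mcircles_eq_circ by blast

lemma circ_in_mcircles: "\<beta>\<^sup>2 + \<gamma>\<^sup>2 > 4 * \<alpha> * \<delta> \<Longrightarrow> circ \<alpha> \<beta> \<gamma> \<delta> \<in> mcircles"
  unfolding mcircles_eq_circ by blast

section \<open>Inversions and their action on circles\<close>

definition inversion :: "real^2 \<Rightarrow> mpoint \<Rightarrow> mpoint" where
  "inversion o' P = (case P of None \<Rightarrow> Some o'
     | Some p \<Rightarrow> if p = o' then None else Some (o' + (1 / (norm (p - o'))\<^sup>2) *\<^sub>R (p - o')))"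

lemma inversion_inversion [simp]: "inversion z (inversion z P) = P"
proof (cases P)
  case (Some p)
  show ?thesis
  proof (cases "p = z")
    case False
    have "norm ((1 / (norm (p - z))\<^sup>2) *\<^sub>R (p - z)) = 1 / norm (p - z)"
      using False by (simp add: power2_eq_square)
    then show ?thesis
      using Some False by (simp add: inversion_def power_divide)
  qed (simp add: Some inversion_def)
qed (simp add: inversion_def)

lemma inversion_eq_iff: "inversion z P = Q \<longleftrightarrow> P = inversion z Q"
  by auto

lemma inversion_None [simp]: "inversion z None = Some z"
  by (simp add: inversion_def)

lemma inversion_center [simp]: "inversion z (Some z) = None"
  by (simp add: inversion_def)

text \<open>In coordinates centred at \<open>z\<close>, substituting the inverted point and
  multiplying by the squared distance exchanges the leading and the constant coefficient. The
  discriminant is symmetric in these two. Since inversion is an involution, the preimage is also the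
  image.\<close>

lemma vimage_inversion_mcircles:
  assumes "C \<in> mcircles"
  shows "inversion z -` C \<in> mcircles"
proof -
  obtain \<alpha> \<beta> \<gamma> \<delta> where C: "C = circ \<alpha> \<beta> \<gamma> \<delta>" and D: "\<beta>\<^sup>2 + \<gamma>\<^sup>2 > 4 * \<alpha> * \<delta>"
    using assms by (rule mcirclesE)
  define a b where "a = z$1" and "b = z$2"
  \<comment> \<open>the equation of \<open>C\<close> in coordinates centred at \<open>z\<close>\<close>
  define \<beta>' \<gamma>' \<delta>' where "\<beta>' = \<beta> + 2 * \<alpha> * a" and "\<gamma>' = \<gamma> + 2 * \<alpha> * b"
    and "\<delta>' = \<alpha> * (a\<^sup>2 + b\<^sup>2) + \<beta> * a + \<gamma> * b + \<delta>"
  have D': "\<beta>'\<^sup>2 + \<gamma>'\<^sup>2 - 4 * \<delta>' * \<alpha> = \<beta>\<^sup>2 + \<gamma>\<^sup>2 - 4 * \<alpha> * \<delta>"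
    unfolding \<beta>'_def \<gamma>'_def \<delta>'_def by algebra
  \<comment> \<open>The equation with leading and constant coefficient exchanged, translated back
    from coordinates centred at \<open>z\<close>.\<close>
  define B where "B = circ \<delta>' (\<beta>' - 2 * \<delta>' * a) (\<gamma>' - 2 * \<delta>' * b)
    (\<alpha> - \<beta>' * a - \<gamma>' * b + \<delta>' * (a\<^sup>2 + b\<^sup>2))"
  have "(\<beta>' - 2 * \<delta>' * a)\<^sup>2 + (\<gamma>' - 2 * \<delta>' * b)\<^sup>2
      - 4 * \<delta>' * (\<alpha> - \<beta>' * a - \<gamma>' * b + \<delta>' * (a\<^sup>2 + b\<^sup>2)) = \<beta>'\<^sup>2 + \<gamma>'\<^sup>2 - 4 * \<delta>' * \<alpha>"
    by algebra
  then have "B \<in> mcircles"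
    unfolding B_def using D D' by (intro circ_in_mcircles) linarith
  moreover have "inversion z -` C = B"
    unfolding set_eq_option_iff
  proof (intro conjI allI)
    show "None \<in> inversion z -` C \<longleftrightarrow> None \<in> B"
      by (simp add: C B_def \<delta>'_def a_def b_def)
    fix p :: "real^2"
    show "Some p \<in> inversion z -` C \<longleftrightarrow> Some p \<in> B"
    proof (cases "p = z")
      case True
      have "\<delta>' * (a\<^sup>2 + b\<^sup>2) + (\<beta>' - 2 * \<delta>' * a) * a + (\<gamma>' - 2 * \<delta>' * b) * b
          + (\<alpha> - \<beta>' * a - \<gamma>' * b + \<delta>' * (a\<^sup>2 + b\<^sup>2)) = \<alpha>"
        by (simp add: algebra_simps power2_eq_square)
      then have "Some p \<in> B \<longleftrightarrow> \<alpha> = 0"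
        unfolding B_def Some_in_circ True a_def[symmetric] b_def[symmetric] by (simp only:)
      then show ?thesis using True by (simp add: C)
    next
      case False
      define x y N where "x = p$1 - a" and "y = p$2 - b" and "N = x\<^sup>2 + y\<^sup>2"
      have N: "N \<noteq> 0" "(norm (p - z))\<^sup>2 = N"
        using False by (auto simp: N_def x_def y_def a_def b_def norm_vec2_squared
            vec_eq_iff forall_2)
      have "x / N * (x / N) + y / N * (y / N) = N / (N * N)"
        unfolding N_def by (simp add: add_divide_distrib power2_eq_square)
      then have inv: "(x / N)\<^sup>2 + (y / N)\<^sup>2 = 1 / N"
        using N(1) by (simp add: power2_eq_square)
      have "\<alpha> * ((a + x / N)\<^sup>2 + (b + y / N)\<^sup>2) + \<beta> * (a + x / N) + \<gamma> * (b + y / N) + \<delta>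
          = \<alpha> * ((x / N)\<^sup>2 + (y / N)\<^sup>2) + \<beta>' * (x / N) + \<gamma>' * (y / N) + \<delta>'"
        unfolding \<beta>'_def \<gamma>'_def \<delta>'_def by algebra
      also have "\<dots> = (\<alpha> + \<beta>' * x + \<gamma>' * y + \<delta>' * N) / N"
        unfolding inv using N(1) by (simp add: add_divide_distrib)
      also have "\<alpha> + \<beta>' * x + \<gamma>' * y + \<delta>' * N = \<delta>' * ((p$1)\<^sup>2 + (p$2)\<^sup>2)
          + (\<beta>' - 2 * \<delta>' * a) * p$1 + (\<gamma>' - 2 * \<delta>' * b) * p$2
          + (\<alpha> - \<beta>' * a - \<gamma>' * b + \<delta>' * (a\<^sup>2 + b\<^sup>2))"
        unfolding N_def x_def y_def by algebra
      finally show ?thesis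
        using False N by (simp add: C B_def inversion_def x_def y_def a_def b_def)
    qed
  qed
  ultimately show ?thesis by simp
qed

section \<open>Charts adapted to a circle\<close>

text \<open>
  Circles keep their usual equations in a chart, \<open>z\<close> plays the role of infinity, and \<open>K\<close> becomes the
  first coordinate axis. Nothing is said about the value of \<open>f\<close> at \<open>z\<close>.
\<close>

definition chart :: "mpoint set \<Rightarrow> mpoint \<Rightarrow> (mpoint \<Rightarrow> real \<times> real) \<Rightarrow> bool" where
  "chart K z f \<longleftrightarrow> bij_betw f (- {z}) UNIV \<and>
     (\<forall>P. P \<noteq> z \<longrightarrow> (P \<in> K \<longleftrightarrow> snd (f P) = 0)) \<and>
     (\<forall>C \<in> mcircles. \<exists>\<alpha> \<beta> \<gamma> \<delta>. \<beta>\<^sup>2 + \<gamma>\<^sup>2 > 4 * \<alpha> * \<delta> \<and> (z \<in> C \<longleftrightarrow> \<alpha> = 0) \<and>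
        (\<forall>P. P \<noteq> z \<longrightarrow> (P \<in> C \<longleftrightarrow>
           \<alpha> * ((fst (f P))\<^sup>2 + (snd (f P))\<^sup>2) + \<beta> * fst (f P) + \<gamma> * snd (f P) + \<delta> = 0)))"

lemma chartE:
  assumes "chart K z f" "C \<in> mcircles"
  obtains \<alpha> \<beta> \<gamma> \<delta> where "\<beta>\<^sup>2 + \<gamma>\<^sup>2 > 4 * \<alpha> * \<delta>" "z \<in> C \<longleftrightarrow> \<alpha> = 0"
    "\<And>P. P \<noteq> z \<Longrightarrow> P \<in> C \<longleftrightarrow>
       \<alpha> * ((fst (f P))\<^sup>2 + (snd (f P))\<^sup>2) + \<beta> * fst (f P) + \<gamma> * snd (f P) + \<delta> = 0"
proof -
  have "\<exists>\<alpha> \<beta> \<gamma> \<delta>. \<beta>\<^sup>2 + \<gamma>\<^sup>2 > 4 * \<alpha> * \<delta> \<and> (z \<in> C \<longleftrightarrow> \<alpha> = 0) \<and>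
      (\<forall>P. P \<noteq> z \<longrightarrow> (P \<in> C \<longleftrightarrow>
         \<alpha> * ((fst (f P))\<^sup>2 + (snd (f P))\<^sup>2) + \<beta> * fst (f P) + \<gamma> * snd (f P) + \<delta> = 0))"
    using assms unfolding chart_def by (elim conjE) (erule bspec)
  then show ?thesis by (elim exE conjE) (rule that, simp_all only: simp_thms)
qed

lemma chart_on_circle: "chart K z f \<Longrightarrow> P \<noteq> z \<Longrightarrow> P \<in> K \<longleftrightarrow> snd (f P) = 0"
  by (simp add: chart_def)

lemma chart_eq_iff:
  assumes "chart K z f" "P \<noteq> z" "Q \<noteq> z"
  shows "f P = f Q \<longleftrightarrow> P = Q"
proof -
  have "inj_on f (- {z})"
    using assms(1) by (simp add: chart_def bij_betw_def)
  then show ?thesis using assms(2,3) by (simp add: inj_on_eq_iff)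
qed

lemma chart_surj:
  assumes "chart K z f"
  obtains P where "P \<noteq> z" "f P = v"
proof -
  have "v \<in> f ` (- {z})"
    using assms unfolding chart_def bij_betw_def by auto
  then show ?thesis using that by auto
qed

text \<open>The second coordinate is the equation of the line \<open>K\<close> itself, the first
  runs along \<open>K\<close>. Together they form a similarity of ratio sqrt \<open>N\<close>, which
  carries circles to circles.\<close>

lemma exists_chart_at_infinity:
  assumes "K \<in> mcircles" "None \<in> K"
  shows "\<exists>f. chart K None f"
proof -
  obtain b c d where K: "K = circ 0 b c d" and D: "b\<^sup>2 + c\<^sup>2 > 0"
    using assms by (elim mcirclesE) auto
  define N where "N = b\<^sup>2 + c\<^sup>2"
  have N: "N > 0" using D by (simp add: N_def)
  \<comment> \<open>rotated coordinates, rescaled by \<open>N\<close> in place of an orthonormal frame\<close>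
  define f :: "mpoint \<Rightarrow> real \<times> real" where
    "f P = (case P of None \<Rightarrow> (0, 0) | Some p \<Rightarrow> (c * p$1 - b * p$2, b * p$1 + c * p$2 + d))" for P
  define g :: "real \<times> real \<Rightarrow> mpoint" where
    "g v = Some (vector [(c * fst v + b * (snd v - d)) / N, (c * (snd v - d) - b * fst v) / N])" for v
  have "bij_betw f (- {None}) UNIV"
  proof (rule bij_betw_byWitness[where f' = g])
    have "c * (c * x - b * y) + b * (b * x + c * y + d - d) = N * x"
      "c * (b * x + c * y + d - d) - b * (c * x - b * y) = N * y" for x y
      unfolding N_def by algebra+
    then have "g (f (Some p)) = Some p" for p
      using N by (simp add: f_def g_def vec_eq_iff forall_2)
    then show "\<forall>P \<in> - {None}. g (f P) = P"
      by (metis Compl_iff insertCI option.exhaust)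
    have "c * (c * x + b * (y - d)) - b * (c * (y - d) - b * x) = N * x"
      "b * (c * x + b * (y - d)) + c * (c * (y - d) - b * x) = N * (y - d)" for x y
      unfolding N_def by algebra+
    moreover have "c * (u / N) - b * (v / N) = (c * u - b * v) / N"
      "b * (u / N) + c * (v / N) = (b * u + c * v) / N" for u v
      by (simp_all add: diff_divide_distrib add_divide_distrib)
    ultimately have "c * ((c * x + b * (y - d)) / N) - b * ((c * (y - d) - b * x) / N) = x"
      "b * ((c * x + b * (y - d)) / N) + c * ((c * (y - d) - b * x) / N) = y - d" for x y
      using N by simp_all
    then have "f (g (x, y)) = (x, y)" for x y
      by (simp add: f_def g_def)
    then show "\<forall>v \<in> UNIV. f (g v) = v" by auto
  qed (auto simp: g_def)
  moreover have "\<forall>P. P \<noteq> None \<longrightarrow> (P \<in> K \<longleftrightarrow> snd (f P) = 0)"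
    by (auto simp: K f_def)
  moreover have "\<exists>\<alpha> \<beta> \<gamma> \<delta>. \<beta>\<^sup>2 + \<gamma>\<^sup>2 > 4 * \<alpha> * \<delta> \<and> (None \<in> C \<longleftrightarrow> \<alpha> = 0) \<and>
        (\<forall>P. P \<noteq> None \<longrightarrow> (P \<in> C \<longleftrightarrow>
           \<alpha> * ((fst (f P))\<^sup>2 + (snd (f P))\<^sup>2) + \<beta> * fst (f P) + \<gamma> * snd (f P) + \<delta> = 0))"
    if "C \<in> mcircles" for C
  proof -
    obtain \<alpha> \<beta> \<gamma> \<delta> where C: "C = circ \<alpha> \<beta> \<gamma> \<delta>" and D: "\<beta>\<^sup>2 + \<gamma>\<^sup>2 > 4 * \<alpha> * \<delta>"
      using \<open>C \<in> mcircles\<close> by (rule mcirclesE)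
    \<comment> \<open>The equation of \<open>C\<close> is multiplied by \<open>N\<close> before it
      is rewritten in the new coordinates; this keeps \<alpha> as leading coefficient and multiplies
      the discriminant by \<open>N\<close>.\<close>
    define \<beta>' \<gamma>' \<delta>' where "\<beta>' = \<beta> * c - \<gamma> * b" and "\<gamma>' = \<beta> * b + \<gamma> * c - 2 * \<alpha> * d"
      and "\<delta>' = \<alpha> * d\<^sup>2 - (\<beta> * b + \<gamma> * c) * d + N * \<delta>"
    have "\<beta>'\<^sup>2 + \<gamma>'\<^sup>2 - 4 * \<alpha> * \<delta>' = N * (\<beta>\<^sup>2 + \<gamma>\<^sup>2 - 4 * \<alpha> * \<delta>)"
      unfolding \<beta>'_def \<gamma>'_def \<delta>'_def N_def by algebra
    moreover have "N * (\<beta>\<^sup>2 + \<gamma>\<^sup>2 - 4 * \<alpha> * \<delta>) > 0" using N D by simp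
    ultimately have "\<beta>'\<^sup>2 + \<gamma>'\<^sup>2 > 4 * \<alpha> * \<delta>'" by linarith
    moreover have "P \<in> C \<longleftrightarrow> \<alpha> * ((fst (f P))\<^sup>2 + (snd (f P))\<^sup>2)
        + \<beta>' * fst (f P) + \<gamma>' * snd (f P) + \<delta>' = 0" if "P \<noteq> None" for P
    proof -
      obtain p where P: "P = Some p" using \<open>P \<noteq> None\<close> by blast
      have "\<alpha> * ((fst (f P))\<^sup>2 + (snd (f P))\<^sup>2) + \<beta>' * fst (f P) + \<gamma>' * snd (f P) + \<delta>'
          = N * (\<alpha> * ((p$1)\<^sup>2 + (p$2)\<^sup>2) + \<beta> * p$1 + \<gamma> * p$2 + \<delta>)"
        unfolding \<beta>'_def \<gamma>'_def \<delta>'_def N_def f_def P option.case fst_conv snd_conv by algebra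
      then show ?thesis using N C P by simp
    qed
    moreover have "None \<in> C \<longleftrightarrow> \<alpha> = 0" using C by simp
    ultimately show ?thesis by blast
  qed
  ultimately show ?thesis unfolding chart_def by blast
qed

text \<open>Inversion at a finite \<open>z\<close> moves \<open>z\<close> to infinity and turns a
  circle through \<open>z\<close> into a line, which reduces this case to a chart at
  infinity.\<close>

lemma chart_inversion:
  assumes "chart (inversion z -` K) None f"
  shows "chart K (Some z) (f \<circ> inversion z)"
proof -
  have "bij_betw (inversion z) (- {Some z}) (- {None})"
    by (rule bij_betw_byWitness[where f' = "inversion z"]) (auto dest: arg_cong[of _ _ "inversion z"])
  then have "bij_betw (f \<circ> inversion z) (- {Some z}) UNIV"
    using assms unfolding chart_def by (blast intro: bij_betw_trans)
  moreover have ne: "inversion z P \<noteq> None" if "P \<noteq> Some z" for P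
    using that by (simp add: inversion_eq_iff)
  moreover have "\<exists>\<alpha> \<beta> \<gamma> \<delta>. \<beta>\<^sup>2 + \<gamma>\<^sup>2 > 4 * \<alpha> * \<delta> \<and> (Some z \<in> C \<longleftrightarrow> \<alpha> = 0) \<and>
        (\<forall>P. P \<noteq> Some z \<longrightarrow> (P \<in> C \<longleftrightarrow> \<alpha> * ((fst ((f \<circ> inversion z) P))\<^sup>2 + (snd ((f \<circ> inversion z) P))\<^sup>2)
          + \<beta> * fst ((f \<circ> inversion z) P) + \<gamma> * snd ((f \<circ> inversion z) P) + \<delta> = 0))"
    if C: "C \<in> mcircles" for C
  proof -
    obtain \<alpha> \<beta> \<gamma> \<delta> where *: "\<beta>\<^sup>2 + \<gamma>\<^sup>2 > 4 * \<alpha> * \<delta>" "None \<in> inversion z -` C \<longleftrightarrow> \<alpha> = 0"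
      "\<And>P. P \<noteq> None \<Longrightarrow> P \<in> inversion z -` C \<longleftrightarrow>
         \<alpha> * ((fst (f P))\<^sup>2 + (snd (f P))\<^sup>2) + \<beta> * fst (f P) + \<gamma> * snd (f P) + \<delta> = 0"
      using chartE[OF assms vimage_inversion_mcircles[OF C]] by metis
    show ?thesis
      using * ne by (intro exI[of _ \<alpha>] exI[of _ \<beta>] exI[of _ \<gamma>] exI[of _ \<delta>]) (auto simp flip: *(3))
  qed
  moreover have "P \<in> K \<longleftrightarrow> snd ((f \<circ> inversion z) P) = 0" if "P \<noteq> Some z" for P
    using chart_on_circle[OF assms ne[OF that]] by simp
  ultimately show ?thesis unfolding chart_def by blast
qed

lemma exists_chart:
  assumes "K \<in> mcircles" "z \<in> K"
  shows "\<exists>f. chart K z f"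
proof (cases z)
  case None
  then show ?thesis using assms exists_chart_at_infinity by blast
next
  case (Some o')
  have "None \<in> inversion o' -` K" using assms Some by simp
  then show ?thesis
    using Some assms vimage_inversion_mcircles exists_chart_at_infinity chart_inversion by blast
qed

section \<open>Circles and triples of points\<close>

text \<open>A chart finds the whole real axis inside \<open>K\<close>. This leaves room to choose a
  centre of projection on \<open>K\<close> away from finitely many given points.\<close>

lemma infinite_mcircle:
  assumes "K \<in> mcircles"
  shows "infinite K"
proof -
  have "K \<noteq> {}" using assms unfolding mcircles_def by auto
  then obtain z f where f: "chart K z f" using assms exists_chart by blast
  have "(x, 0) \<in> f ` K" for x
    using chart_surj[OF f, of "(x, 0)"] chart_on_circle[OF f] by (metis imageI snd_conv)
  then have "range (\<lambda>x::real. (x, 0::real)) \<subseteq> f ` K" by auto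
  moreover have "infinite (range (\<lambda>x::real. (x, 0::real)))"
    using infinite_UNIV_char_0[where 'a = real] by (simp add: finite_image_iff inj_def)
  ultimately show ?thesis using finite_imageI finite_subset by blast
qed

text \<open>With \<open>P\<close> sent to infinity and \<open>C\<close> as the axis,
  \<open>C'\<close> becomes a line; it meets the axis in the two distinct points \<open>Q\<close>
  and \<open>R\<close>, so it is the axis.\<close>

lemma mcircle_unique:
  assumes "C \<in> mcircles" "C' \<in> mcircles" "P \<noteq> Q" "P \<noteq> R" "Q \<noteq> R"
    "{P, Q, R} \<subseteq> C" "{P, Q, R} \<subseteq> C'"
  shows "C = C'"
proof -
  obtain f where f: "chart C P f" using exists_chart assms by blast
  obtain \<alpha> \<beta> \<gamma> \<delta> where *: "\<beta>\<^sup>2 + \<gamma>\<^sup>2 > 4 * \<alpha> * \<delta>" "P \<in> C' \<longleftrightarrow> \<alpha> = 0"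
    "\<And>P'. P' \<noteq> P \<Longrightarrow> P' \<in> C' \<longleftrightarrow>
       \<alpha> * ((fst (f P'))\<^sup>2 + (snd (f P'))\<^sup>2) + \<beta> * fst (f P') + \<gamma> * snd (f P') + \<delta> = 0"
    using chartE[OF f assms(2)] by metis
  have a: "\<alpha> = 0" using * assms by simp
  have Q: "snd (f Q) = 0" and R: "snd (f R) = 0"
    using chart_on_circle[OF f] assms by auto
  then have ne: "fst (f Q) \<noteq> fst (f R)"
    using chart_eq_iff[OF f, of Q R] assms by (simp add: prod_eq_iff)
  have eqs: "\<beta> * fst (f Q) + \<delta> = 0" "\<beta> * fst (f R) + \<delta> = 0"
    using *(3)[of Q] *(3)[of R] assms Q R a by auto
  have "\<beta> * (fst (f Q) - fst (f R)) = (\<beta> * fst (f Q) + \<delta>) - (\<beta> * fst (f R) + \<delta>)"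
    by (simp add: right_diff_distrib)
  then have "\<beta> * (fst (f Q) - fst (f R)) = 0" unfolding eqs by simp
  then have b: "\<beta> = 0" using ne by simp
  with eqs have d: "\<delta> = 0" by simp
  have "\<gamma> \<noteq> 0" using *(1) a b by auto
  then have "X \<in> C \<longleftrightarrow> X \<in> C'" for X
    using *(3)[of X] chart_on_circle[OF f, of X] a b d assms by (cases "X = P") auto
  then show ?thesis by blast
qed

text \<open>If one of the points is infinity, the line through the other two is the circle;
  otherwise an inversion at \<open>P\<close> produces this situation.\<close>

lemma mcircle_exists:
  assumes "P \<noteq> Q" "P \<noteq> R" "Q \<noteq> R"
  shows "\<exists>C \<in> mcircles. {P, Q, R} \<subseteq> C"
proof -
  have at_inf: "\<exists>C \<in> mcircles. {None, Q', R'} \<subseteq> C" if ne: "Q' \<noteq> None" "R' \<noteq> None" "Q' \<noteq> R'" for Q' R'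
  proof -
    obtain q r where qr: "Q' = Some q" "R' = Some r" "q \<noteq> r" using ne by auto
    have "insert None (Some ` (affine hull {q, r})) \<in> mcircles"
      unfolding mcircles_def using qr by blast
    moreover have "{None, Q', R'} \<subseteq> insert None (Some ` (affine hull {q, r}))"
      using hull_subset[of "{q, r}" affine] qr by auto
    ultimately show ?thesis by blast
  qed
  show ?thesis
  proof (cases P)
    case None
    then have "Q \<noteq> None" "R \<noteq> None" using assms by simp_all
    then show ?thesis unfolding None using at_inf assms(3) by blast
  next
    case (Some z)
    then have "inversion z Q \<noteq> None" "inversion z R \<noteq> None"
      using assms by (metis inversion_inversion inversion_None)+
    moreover have "inversion z Q \<noteq> inversion z R"
      using assms by (metis inversion_inversion)
    ultimately obtain C where C: "C \<in> mcircles" "{None, inversion z Q, inversion z R} \<subseteq> C"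
      using at_inf by blast
    then have "{P, Q, R} \<subseteq> inversion z -` C" using Some by auto
    then show ?thesis by (rule bexI[OF _ vimage_inversion_mcircles[OF C(1)]])
  qed
qed

section \<open>The octahedron theorem\<close>

text \<open>
  A circle through the points \<open>(a, 0)\<close> and \<open>(b, 0)\<close> of the first axis is written
  \<open>(x - a) * (x - b) + y\<^sup>2 + t * (b - a) * y = 0\<close>, where \<open>t\<close> is the cotangent of its directed angle
  with the axis. Three circles over the sides of a degenerate triangle on the axis concur iff their
  angles add up to \<open>0\<close> modulo \<open>\<pi>\<close>, and \<open>cayley t\<close> is the exponential of \<open>2 * \<i>\<close> times the angle.
\<close>

lemma concurrent_iff:
  fixes a b c X Y Z :: real
  assumes "a \<noteq> b" "b \<noteq> c" "c \<noteq> a"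
  shows "(\<exists>x y. y \<noteq> 0 \<and> (x - a) * (x - b) + y\<^sup>2 + X * (b - a) * y = 0
      \<and> (x - b) * (x - c) + y\<^sup>2 + Y * (c - b) * y = 0
      \<and> (x - c) * (x - a) + y\<^sup>2 + Z * (a - c) * y = 0)
    \<longleftrightarrow> X * Y + Y * Z + Z * X = 1" (is "?L \<longleftrightarrow> ?R")
proof
  assume ?L
  then obtain x y where y: "y \<noteq> 0" and
    e: "(x - a) * (x - b) + y\<^sup>2 + X * (b - a) * y = 0"
      "(x - b) * (x - c) + y\<^sup>2 + Y * (c - b) * y = 0"
      "(x - c) * (x - a) + y\<^sup>2 + Z * (a - c) * y = 0" by blast
  define p q r where "p = X * (b - a) * y" and "q = Y * (c - b) * y" and "r = Z * (a - c) * y"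
  have p: "p = - ((x - a) * (x - b) + y\<^sup>2)" and q: "q = - ((x - b) * (x - c) + y\<^sup>2)"
    and r: "r = - ((x - c) * (x - a) + y\<^sup>2)"
    using e by (simp_all add: p_def q_def r_def)
  \<comment> \<open>Each product of two of \<open>p\<close>, \<open>q\<close>, \<open>r\<close> is
    weighted by the side belonging to the third, which makes all terms multiples of the same product
    of sides. Replacing \<open>p\<close>, \<open>q\<close>, \<open>r\<close> by the circle equations
    then eliminates \<open>x\<close>.\<close>
  have "y\<^sup>2 * ((b - a) * (c - b) * (a - c)) * (X * Y + Y * Z + Z * X)
      = p * q * (a - c) + q * r * (b - a) + r * p * (c - b)"
    unfolding p_def q_def r_def by algebra
  also have "\<dots> = y\<^sup>2 * ((b - a) * (c - b) * (a - c)) * 1"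
    unfolding p q r by algebra
  finally show ?R using y assms by simp
next
  assume R: ?R
  \<comment> \<open>\<open>X + Y = 0\<close> would make the first two circles tangent at
    \<open>(b, 0)\<close>, leaving no second intersection.\<close>
  have s: "X + Y \<noteq> 0"
  proof
    assume "X + Y = 0"
    then have "Y = - X" by simp
    then have "X\<^sup>2 = - 1" using R by (simp add: power2_eq_square)
    then show False using zero_le_power2[of X] by linarith
  qed
  \<comment> \<open>the second intersection of the first two circles, on the line \<open>x = b + m * y\<close>\<close>
  define m where "m = (X * (b - a) - Y * (c - b)) / (a - c)"
  define y where "y = - ((b - a) * (m + X)) / (m\<^sup>2 + 1)"
  define x where "x = b + m * y"
  have m: "m * (a - c) = X * (b - a) - Y * (c - b)"
    using assms by (simp add: m_def)
  have "m\<^sup>2 + 1 \<noteq> 0" using zero_le_power2[of m] by linarith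
  then have y: "y * (m\<^sup>2 + 1) = - ((b - a) * (m + X))" by (simp add: y_def)
  have "(m + X) * (a - c) = (X + Y) * (b - c)" using m by algebra
  then have "m + X \<noteq> 0" using s assms by auto
  then have y0: "y \<noteq> 0" using y assms by auto
  have e1: "(x - a) * (x - b) + y\<^sup>2 + X * (b - a) * y = 0"
    unfolding x_def using y by algebra
  have e2: "(x - b) * (x - c) + y\<^sup>2 + Y * (c - b) * y = 0"
    unfolding x_def using y m by algebra
  have e3: "(x - c) * (x - a) + y\<^sup>2 + Z * (a - c) * y = 0"
  proof -
    \<comment> \<open>The last factor is the third circle equation minus the first on the line
      \<open>x = b + m * y\<close>. The nonzero factors in front clear the denominators of
      \<open>Z\<close>, \<open>y\<close> and \<open>m\<close>.\<close>
    have "(X + Y) * (m\<^sup>2 + 1) * (a - c) * ((b - c) * (b - a + m * y) + (Z * (a - c) - X * (b - a)) * y) = 0"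
      using R m y by algebra
    then have "(b - c) * (b - a + m * y) + (Z * (a - c) - X * (b - a)) * y = 0"
      using s \<open>m\<^sup>2 + 1 \<noteq> 0\<close> assms by simp
    then show ?thesis using e1 unfolding x_def by algebra
  qed
  show ?L using y0 e1 e2 e3 by blast
qed

definition cayley :: "real \<Rightarrow> complex" where
  "cayley t = Complex t 1 / Complex t (- 1)"

text \<open>Numerator and denominator of the product are complex conjugates, so it is 1 iff (X +
  i)(Y + i)(Z + i) is real; its imaginary part is XY + YZ + ZX - 1. The multiplicative form is the
  one that cancels between neighbouring faces.\<close>

lemma cayley_prod_eq_1_iff:
  "cayley X * cayley Y * cayley Z = 1 \<longleftrightarrow> X * Y + Y * Z + Z * X = 1"
proof -
  have nz: "Complex t (- 1) \<noteq> 0" for t by (simp add: complex_eq_iff)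
  have "cayley X * cayley Y * cayley Z = 1 \<longleftrightarrow>
      Complex X 1 * Complex Y 1 * Complex Z 1 = Complex X (- 1) * Complex Y (- 1) * Complex Z (- 1)"
    unfolding cayley_def using nz[of X] nz[of Y] nz[of Z] by (simp add: field_simps)
  also have "\<dots> \<longleftrightarrow> X * Y + Y * Z + Z * X = 1"
    by (auto simp: complex_eq_iff algebra_simps)
  finally show ?thesis .
qed

text \<open>If \<open>C\<close> contained \<open>z\<close>, it would share three points with
  \<open>K\<close> and equal it. So its leading coefficient is nonzero, and on the axis its equation
  is a quadratic with the two given points as roots; only the coefficient of the second coordinate
  remains free.\<close>

lemma chart_circle_through:
  assumes "chart K z f" "K \<in> mcircles" "z \<in> K" "C \<in> mcircles" "C \<noteq> K"
    "P \<noteq> Q" "P \<in> C \<inter> K - {z}" "Q \<in> C \<inter> K - {z}"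
  obtains t where "\<And>R. R \<noteq> z \<Longrightarrow> R \<in> C \<longleftrightarrow>
    (fst (f R) - fst (f P)) * (fst (f R) - fst (f Q)) + (snd (f R))\<^sup>2
      + t * (fst (f Q) - fst (f P)) * snd (f R) = 0"
proof -
  obtain \<alpha> \<beta> \<gamma> \<delta> where "z \<in> C \<longleftrightarrow> \<alpha> = 0" and
    eq: "\<And>R. R \<noteq> z \<Longrightarrow> R \<in> C \<longleftrightarrow>
       \<alpha> * ((fst (f R))\<^sup>2 + (snd (f R))\<^sup>2) + \<beta> * fst (f R) + \<gamma> * snd (f R) + \<delta> = 0"
    using chartE[OF assms(1,4)] by metis
  have "z \<notin> C"
    using mcircle_unique[of C K z P Q] assms by auto
  then have \<alpha>: "\<alpha> \<noteq> 0" using \<open>z \<in> C \<longleftrightarrow> \<alpha> = 0\<close> by simp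
  define a b where "a = fst (f P)" and "b = fst (f Q)"
  have "snd (f P) = 0" "snd (f Q) = 0"
    using chart_on_circle[OF assms(1)] assms(7,8) by auto
  then have ab: "a \<noteq> b"
    using chart_eq_iff[OF assms(1), of P Q] assms(6-8) by (auto simp: a_def b_def prod_eq_iff)
  have a: "\<alpha> * a\<^sup>2 + \<beta> * a + \<delta> = 0" and b: "\<alpha> * b\<^sup>2 + \<beta> * b + \<delta> = 0"
    using eq[of P] eq[of Q] assms(7,8) \<open>snd (f P) = 0\<close> \<open>snd (f Q) = 0\<close> by (auto simp: a_def b_def)
  have "(a - b) * (\<alpha> * (a + b) + \<beta>) = 0"
    using arg_cong2[OF a b, of minus] by (simp add: algebra_simps power2_eq_square)
  then have \<beta>: "\<beta> = - (\<alpha> * (a + b))" using ab by auto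
  have \<delta>: "\<delta> = \<alpha> * (a * b)"
    using a unfolding \<beta> by (simp add: algebra_simps power2_eq_square)
  define t where "t = \<gamma> / (\<alpha> * (b - a))"
  have \<gamma>: "\<gamma> = \<alpha> * (t * (b - a))" using \<alpha> ab by (simp add: t_def)
  have "R \<in> C \<longleftrightarrow> (fst (f R) - a) * (fst (f R) - b) + (snd (f R))\<^sup>2 + t * (b - a) * snd (f R) = 0"
    if "R \<noteq> z" for R
  proof -
    have "\<alpha> * ((fst (f R))\<^sup>2 + (snd (f R))\<^sup>2) + \<beta> * fst (f R) + \<gamma> * snd (f R) + \<delta>
        = \<alpha> * ((fst (f R) - a) * (fst (f R) - b) + (snd (f R))\<^sup>2 + t * (b - a) * snd (f R))"
      unfolding \<beta> \<gamma> \<delta> by (simp add: algebra_simps power2_eq_square)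
    then show ?thesis using eq[OF that] \<alpha> by simp
  qed
  then show ?thesis using that unfolding a_def b_def by blast
qed

text \<open>Opposite vertices are \<open>a i\<close> and \<open>a (- i)\<close>, and likewise for
  \<open>b\<close> and \<open>c\<close>; \<open>A\<close>, \<open>B\<close>, \<open>C\<close> are
  the edge circles in cyclic order, hence \<open>C k i\<close>. Keeping \<open>x i j k\<close> away
  from \<open>a i\<close> and \<open>b j\<close> keeps it off \<open>K\<close>, where the angle
  criterion applies.\<close>

lemma octahedron:
  fixes a b c :: "int \<Rightarrow> mpoint" and A B C :: "int \<Rightarrow> int \<Rightarrow> mpoint set"
    and x :: "int \<Rightarrow> int \<Rightarrow> int \<Rightarrow> mpoint" and S :: "int set"
  defines "S \<equiv> {-1, 1}"
  assumes K: "K \<in> mcircles" "\<And>i. i \<in> S \<Longrightarrow> {a i, b i, c i} \<subseteq> K"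
    and ne: "\<And>i j. i \<in> S \<Longrightarrow> j \<in> S \<Longrightarrow> a i \<noteq> b j \<and> b i \<noteq> c j \<and> c i \<noteq> a j"
    and A: "\<And>i j. i \<in> S \<Longrightarrow> j \<in> S \<Longrightarrow> A i j \<in> mcircles - {K} \<and> {a i, b j} \<subseteq> A i j"
    and B: "\<And>i j. i \<in> S \<Longrightarrow> j \<in> S \<Longrightarrow> B i j \<in> mcircles - {K} \<and> {b i, c j} \<subseteq> B i j"
    and C: "\<And>i j. i \<in> S \<Longrightarrow> j \<in> S \<Longrightarrow> C i j \<in> mcircles - {K} \<and> {c i, a j} \<subseteq> C i j"
    and x: "\<And>i j k. i \<in> S \<Longrightarrow> j \<in> S \<Longrightarrow> k \<in> S \<Longrightarrow> (i, j, k) \<noteq> (1, 1, 1) \<Longrightarrow>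
      x i j k \<in> A i j \<inter> B j k \<inter> C k i \<and> x i j k \<notin> {a i, b j}"
  shows "A 1 1 \<inter> B 1 1 \<inter> C 1 1 \<noteq> {}"
proof -
  have S: "finite S" "1 \<in> S" "-1 \<in> S" unfolding S_def by auto
  \<comment> \<open>a chart sending none of the six points to infinity\<close>
  have "infinite (K - (a ` S \<union> b ` S \<union> c ` S))"
    using infinite_mcircle[OF K(1)] S(1) by simp
  then obtain z where "z \<in> K - (a ` S \<union> b ` S \<union> c ` S)"
    by (metis ex_in_conv infinite_imp_nonempty)
  then have z: "z \<in> K" "\<And>i. i \<in> S \<Longrightarrow> a i \<noteq> z" "\<And>i. i \<in> S \<Longrightarrow> b i \<noteq> z" "\<And>i. i \<in> S \<Longrightarrow> c i \<noteq> z"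
    by auto
  obtain f where f: "chart K z f" using exists_chart[OF K(1) z(1)] by blast
  define on where "on D P Q t \<longleftrightarrow> (\<forall>R. R \<noteq> z \<longrightarrow> (R \<in> D \<longleftrightarrow>
    (fst (f R) - fst (f P)) * (fst (f R) - fst (f Q)) + (snd (f R))\<^sup>2
      + t * (fst (f Q) - fst (f P)) * snd (f R) = 0))" for D P Q t
  have on: "\<exists>t. on D P Q t" if "D \<in> mcircles" "D \<noteq> K" "P \<noteq> Q" "P \<in> D \<inter> K - {z}" "Q \<in> D \<inter> K - {z}" for D P Q
    using chart_circle_through[OF f K(1) z(1) that] unfolding on_def by metis
  have "\<forall>i\<in>S. \<forall>j\<in>S. \<exists>t. on (A i j) (a i) (b j) t"
    using A K(2) z ne by (intro ballI on) auto
  then obtain u where u: "\<And>i j. i \<in> S \<Longrightarrow> j \<in> S \<Longrightarrow> on (A i j) (a i) (b j) (u i j)"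
    by metis
  have "\<forall>i\<in>S. \<forall>j\<in>S. \<exists>t. on (B i j) (b i) (c j) t"
    using B K(2) z ne by (intro ballI on) auto
  then obtain v where v: "\<And>i j. i \<in> S \<Longrightarrow> j \<in> S \<Longrightarrow> on (B i j) (b i) (c j) (v i j)"
    by metis
  have "\<forall>i\<in>S. \<forall>j\<in>S. \<exists>t. on (C i j) (c i) (a j) t"
    using C K(2) z ne by (intro ballI on) auto
  then obtain w where w: "\<And>i j. i \<in> S \<Longrightarrow> j \<in> S \<Longrightarrow> on (C i j) (c i) (a j) (w i j)"
    by metis
  have fst_ne: "fst (f P) \<noteq> fst (f Q)" if "P \<in> K - {z}" "Q \<in> K - {z}" "P \<noteq> Q" for P Q
    using that chart_eq_iff[OF f, of P Q] chart_on_circle[OF f] by (auto simp: prod_eq_iff)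
  \<comment> \<open>Points off \<open>K\<close> are those with nonzero second coordinate. They avoid
    \<open>z\<close> automatically, since \<open>z\<close> lies on \<open>K\<close>, so the chart
    misses none of them.\<close>
  have face: "(\<exists>R. R \<in> A i j \<inter> B j k \<inter> C k i - K) \<longleftrightarrow> cayley (u i j) * cayley (v j k) * cayley (w k i) = 1"
    if ijk: "i \<in> S" "j \<in> S" "k \<in> S" for i j k
  proof -
    let ?P = "\<lambda>x y. y \<noteq> 0
      \<and> (x - fst (f (a i))) * (x - fst (f (b j))) + y\<^sup>2 + u i j * (fst (f (b j)) - fst (f (a i))) * y = 0
      \<and> (x - fst (f (b j))) * (x - fst (f (c k))) + y\<^sup>2 + v j k * (fst (f (c k)) - fst (f (b j))) * y = 0
      \<and> (x - fst (f (c k))) * (x - fst (f (a i))) + y\<^sup>2 + w k i * (fst (f (a i)) - fst (f (c k))) * y = 0"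
    have P: "R \<in> A i j \<inter> B j k \<inter> C k i - K \<longleftrightarrow> ?P (fst (f R)) (snd (f R))" if "R \<noteq> z" for R
      using u[of i j] v[of j k] w[of k i] ijk that chart_on_circle[OF f that] unfolding on_def by auto
    have "(\<exists>R. R \<in> A i j \<inter> B j k \<inter> C k i - K) \<longleftrightarrow> (\<exists>x y. ?P x y)"
    proof
      assume "\<exists>R. R \<in> A i j \<inter> B j k \<inter> C k i - K"
      then obtain R where R: "R \<in> A i j \<inter> B j k \<inter> C k i - K" ..
      then have "R \<noteq> z" using z(1) by blast
      then show "\<exists>x y. ?P x y" using P R by blast
    next
      assume "\<exists>x y. ?P x y"
      then obtain x y where xy: "?P x y" by blast
      obtain R where R: "R \<noteq> z" "f R = (x, y)" using chart_surj[OF f] .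
      then have "?P (fst (f R)) (snd (f R))" using xy by simp
      then show "\<exists>R. R \<in> A i j \<inter> B j k \<inter> C k i - K" using P[OF R(1)] by blast
    qed
    also have "\<dots> \<longleftrightarrow> u i j * v j k + v j k * w k i + w k i * u i j = 1"
      using K(2) z ne ijk by (intro concurrent_iff fst_ne) auto
    finally show ?thesis by (simp only: cayley_prod_eq_1_iff)
  qed
  have seven: "cayley (u i j) * cayley (v j k) * cayley (w k i) = 1"
    if ijk: "i \<in> S" "j \<in> S" "k \<in> S" "(i, j, k) \<noteq> (1, 1, 1)" for i j k
  proof -
    \<comment> \<open>Otherwise \<open>A i j\<close> and \<open>K\<close> would have the three
      points \<open>a i\<close>, \<open>b j\<close>, \<open>x i j k\<close> in common.\<close>
    have "x i j k \<notin> K"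
      using mcircle_unique[of "A i j" K "a i" "b j" "x i j k"] x[OF ijk] A[OF ijk(1,2)] K
        ne[OF ijk(1,2)] ijk by auto
    then show ?thesis using face[OF ijk(1-3)] x[OF ijk] by blast
  qed
  \<comment> \<open>each edge lies on two faces, so the alternating product over the eight faces is \<open>1\<close>\<close>
  define U V W where "U i j = cayley (u i j)" and "V i j = cayley (v i j)" and "W i j = cayley (w i j)" for i j
  have s: "U i j * V j k * W k i = 1" if "i \<in> S" "j \<in> S" "k \<in> S" "(i, j, k) \<noteq> (1, 1, 1)" for i j k
    using seven that unfolding U_def V_def W_def by blast
  \<comment> \<open>The left side collects the faces with positive sign product, the right side
    those with negative one. Faces sharing an edge have opposite sign products, so each edge value
    occurs once on each side.\<close>
  have "(U 1 1 * V 1 1 * W 1 1) * (U 1 (-1) * V (-1) (-1) * W (-1) 1) *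
      (U (-1) 1 * V 1 (-1) * W (-1) (-1)) * (U (-1) (-1) * V (-1) 1 * W 1 (-1))
    = (U 1 1 * V 1 (-1) * W (-1) 1) * (U 1 (-1) * V (-1) 1 * W 1 1) *
      (U (-1) 1 * V 1 1 * W 1 (-1)) * (U (-1) (-1) * V (-1) (-1) * W (-1) (-1))"
    by (simp only: mult_ac)
  then have "U 1 1 * V 1 1 * W 1 1 = 1"
    using S by (simp add: s)
  then have "\<exists>R. R \<in> A 1 1 \<inter> B 1 1 \<inter> C 1 1 - K"
    using face[of 1 1 1] S unfolding U_def V_def W_def by blast
  then show ?thesis by blast
qed

section \<open>Continuation by one layer\<close>

lemma height_add_axis [simp]:
  "height (n + axis i 1) = height n + 1" "height (n - axis i 1) = height n - 1"
  by (simp_all add: height_def axis_def sum.distrib sum_subtractf)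

lemma height_add_vector [simp]: "height (n + vector [i, j, k]) = height n + (i + j + k)"
  by (simp add: height_def sum_3)

lemma height_uminus [simp]: "height (- n) = - height n"
  by (simp add: height_def sum_negf)

lemma mem_slab [simp]: "n \<in> slab a b \<longleftrightarrow> a \<le> height n \<and> height n \<le> b"
  by (auto simp: slab_def A2_def)

lemma mem_A2 [simp]: "n \<in> A2 k \<longleftrightarrow> height n = k"
  by (simp add: A2_def)

lemma mem_even_lattice [simp]: "n \<in> even_lattice \<longleftrightarrow> even (height n)"
  by (simp add: even_lattice_def)

lemma mem_odd_lattice [simp]: "n \<in> odd_lattice \<longleftrightarrow> odd (height n)"
  by (simp add: odd_lattice_def)

definition adjacent :: "int^3 \<Rightarrow> int^3 \<Rightarrow> bool" where
  "adjacent u v \<longleftrightarrow> (\<exists>i. v = u + std_basis i \<or> u = v + std_basis i)"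

lemma adjacent_axis [simp]:
  "adjacent u (u + axis i 1)" "adjacent (u + axis i 1) u"
  "adjacent u (u - axis i 1)" "adjacent (u - axis i 1) u"
  unfolding adjacent_def by (intro exI[of _ i]; simp)+

lemma adjacent_vector:
  assumes "s \<in> {- 1, 1}"
  shows "adjacent (n + vector [s, j, k]) (n + vector [0, j, k])"
    "adjacent (n + vector [i, s, k]) (n + vector [i, 0, k])"
    "adjacent (n + vector [i, j, s]) (n + vector [i, j, 0])"
  using assms unfolding adjacent_def
  by (intro exI[of _ 1], force simp: vec_eq_iff forall_3 axis_def,
      intro exI[of _ 2], force simp: vec_eq_iff forall_3 axis_def,
      intro exI[of _ 3], force simp: vec_eq_iff forall_3 axis_def)

lemma adjacent_sym: "adjacent u v \<Longrightarrow> adjacent v u"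
  unfolding adjacent_def by blast

lemma adjacent_uminus [simp]: "adjacent (- u) (- v) \<longleftrightarrow> adjacent u v"
proof -
  have "- v = - u + x \<longleftrightarrow> u = v + x" for u v x :: "int^3"
    unfolding vec_eq_iff vector_uminus_component vector_add_component by (intro all_cong1) arith
  then show ?thesis unfolding adjacent_def by auto
qed

lemma incident:
  assumes "point_circle_complex_on D p c" "u \<in> D" "v \<in> D" "even (height u)" "odd (height v)" "adjacent u v"
  shows "p u \<in> c v"
  using assms unfolding point_circle_complex_on_def adjacent_def by auto

lemma circle_in_mcircles:
  assumes "point_circle_complex_on D p c" "v \<in> D" "odd (height v)"
  shows "c v \<in> mcircles"
  using assms unfolding point_circle_complex_on_def by (auto dest: PiE_mem)

lemma generic_on_points:
  assumes "generic_on D p c" "u \<in> D" "u' \<in> D" "even (height u)" "even (height u')" "u \<noteq> u'"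
    "u \<in> block w" "u' \<in> block w"
  shows "p u \<noteq> p u'"
  using assms unfolding generic_on_def inj_on_def by auto

lemma generic_on_circles:
  assumes "generic_on D p c" "v \<in> D" "v' \<in> D" "odd (height v)" "odd (height v')" "v \<noteq> v'"
    "v \<in> block w" "v' \<in> block w"
  shows "c v \<noteq> c v'"
  using assms unfolding generic_on_def inj_on_def by auto

lemma below_in_block: "v - axis i 1 \<in> block (v - 1)"
  by (simp add: block_def axis_def)

lemma generic_on_below:
  assumes "generic_on D p c" "\<And>i. v - axis i 1 \<in> D" "odd (height v)"
  shows "inj (\<lambda>i. p (v - axis i 1))"
proof (rule injI, rule ccontr)
  fix i j :: 3 assume "p (v - axis i 1) = p (v - axis j 1)" "i \<noteq> j"
  then show False
    using generic_on_points[OF assms(1) assms(2)[of i] assms(2)[of j] _ _ _ below_in_block below_in_block]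
      assms(3) by (simp add: axis_eq_axis)
qed

lemma point_circle_complex_onI:
  assumes "\<And>u. u \<notin> D \<or> odd (height u) \<Longrightarrow> p u = undefined"
    "\<And>v. v \<notin> D \<or> even (height v) \<Longrightarrow> c v = undefined"
    "\<And>v. v \<in> D \<Longrightarrow> odd (height v) \<Longrightarrow> c v \<in> mcircles"
    "\<And>u v. u \<in> D \<Longrightarrow> v \<in> D \<Longrightarrow> even (height u) \<Longrightarrow> odd (height v) \<Longrightarrow> adjacent u v \<Longrightarrow> p u \<in> c v"
  shows "point_circle_complex_on D p c"
  using assms unfolding point_circle_complex_on_def adjacent_def PiE_def extensional_def by auto

lemma point_undefined:
  "point_circle_complex_on D p c \<Longrightarrow> u \<notin> D \<or> odd (height u) \<Longrightarrow> p u = undefined"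
  unfolding point_circle_complex_on_def by (auto dest!: PiE_arb)

lemma circle_undefined:
  "point_circle_complex_on D p c \<Longrightarrow> v \<notin> D \<or> even (height v) \<Longrightarrow> c v = undefined"
  unfolding point_circle_complex_on_def by (auto dest!: PiE_arb)

lemma adjacent_height: "adjacent u v \<Longrightarrow> height v = height u + 1 \<or> height v = height u - 1"
  unfolding adjacent_def by auto

lemma adjacent_below: "adjacent u v \<Longrightarrow> height v = height u + 1 \<Longrightarrow> \<exists>i. u = v - axis i 1"
  unfolding adjacent_def by (auto simp: algebra_simps)

lemma mcircle_exists_3:
  fixes f :: "3 \<Rightarrow> mpoint"
  assumes "inj f"
  shows "\<exists>C \<in> mcircles. \<forall>i. f i \<in> C"
  using mcircle_exists[of "f 1" "f 2" "f 3"] assms by (simp add: forall_3 inj_eq)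

lemma mcircle_unique_3:
  fixes f :: "3 \<Rightarrow> mpoint"
  assumes "inj f" "C \<in> mcircles" "\<And>i. f i \<in> C" "C' \<in> mcircles" "\<And>i. f i \<in> C'"
  shows "C = C'"
  using mcircle_unique[of C C' "f 1" "f 2" "f 3"] assms by (simp add: inj_eq)

lemma circle_through_3:
  fixes f :: "3 \<Rightarrow> mpoint"
  assumes "inj f" "C \<in> mcircles" "\<And>i. f i \<in> C"
  shows "circle_through {f i | i. True} = C"
  unfolding circle_through_def
proof (rule the_equality)
  show "C' = C" if "C' \<in> mcircles \<and> {f i | i. True} \<subseteq> C'" for C'
    by (rule mcircle_unique_3[OF assms(1)]) (use that assms in auto)
qed (use assms in auto)

section \<open>Adding a layer on top\<close>

text \<open>A vertex of the new layer has only its three lower neighbours in the slab. They lie in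
  one block, so their points are distinct and span a circle without further conditions.\<close>

lemma extend_up_odd:
  assumes pc: "point_circle_complex_on (slab a b) p c" and gen: "generic_on (slab a b) p c"
    and "a \<le> b" "even b"
  shows "\<exists>p' c'. point_circle_complex_on (slab a (b + 1)) p' c' \<and> agree_on (slab a b) p' c' p c"
proof -
  have "\<exists>C \<in> mcircles. \<forall>i. p (v - axis i 1) \<in> C" if "height v = b + 1" for v
    by (rule mcircle_exists_3, rule generic_on_below[OF gen]) (use that assms in auto)
  then obtain C where C: "\<And>v. height v = b + 1 \<Longrightarrow> C v \<in> mcircles \<and> (\<forall>i. p (v - axis i 1) \<in> C v)"
    by metis
  define c' where "c' v = (if height v = b + 1 then C v else c v)" for v
  have "point_circle_complex_on (slab a (b + 1)) p c'"
  proof (rule point_circle_complex_onI)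
    fix u v assume uv: "u \<in> slab a (b + 1)" "v \<in> slab a (b + 1)" "even (height u)" "odd (height v)" "adjacent u v"
    have u: "height u \<noteq> b + 1" using uv assms by auto
    show "p u \<in> c' v"
    proof (cases "height v = b + 1")
      case True
      then show ?thesis
        using C adjacent_height[OF uv(5)] adjacent_below[OF uv(5)] uv(1) by (auto simp: c'_def)
    next
      case False
      then show ?thesis
        using incident[OF pc, of u v] u uv by (auto simp: c'_def)
    qed
  qed (use assms C point_undefined[OF pc] circle_undefined[OF pc] circle_in_mcircles[OF pc]
       in \<open>auto simp: c'_def\<close>)
  moreover have "agree_on (slab a b) p c' p c"
    by (auto simp: agree_on_def c'_def)
  ultimately show ?thesis by blast
qed

text \<open>Three circles need not concur, so concurrence is a hypothesis here: beyond the Cauchy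
  data the octahedron theorem supplies it, at layer 2 the assumption on the initial points
  does.\<close>

lemma extend_up_even:
  assumes pc: "point_circle_complex_on (slab a b) p c" and "a \<le> b" "odd b"
    and "\<And>u. height u = b + 1 \<Longrightarrow> \<exists>x. \<forall>i. x \<in> c (u - axis i 1)"
  shows "\<exists>p' c'. point_circle_complex_on (slab a (b + 1)) p' c' \<and> agree_on (slab a b) p' c' p c"
proof -
  obtain X where X: "\<And>u. height u = b + 1 \<Longrightarrow> \<forall>i. X u \<in> c (u - axis i 1)"
    using assms(4) by metis
  have odd_le: "h \<le> b" if "h \<le> b + 1" "odd h" for h
    using that \<open>odd b\<close> by (cases "h = b + 1") auto
  define p' where "p' u = (if height u = b + 1 then X u else p u)" for u
  have "point_circle_complex_on (slab a (b + 1)) p' c"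
  proof (rule point_circle_complex_onI)
    fix u v assume uv: "u \<in> slab a (b + 1)" "v \<in> slab a (b + 1)" "even (height u)" "odd (height v)" "adjacent u v"
    have v: "height v \<noteq> b + 1" using uv assms by auto
    show "p' u \<in> c v"
    proof (cases "height u = b + 1")
      case True
      then show ?thesis
        using X adjacent_height[OF uv(5)] adjacent_below[OF adjacent_sym[OF uv(5)]] uv(2)
        by (auto simp: p'_def)
    next
      case False
      then show ?thesis
        using incident[OF pc, of u v] v uv by (auto simp: p'_def)
    qed
  qed (use assms point_undefined[OF pc] circle_undefined[OF pc] circle_in_mcircles[OF pc]
       odd_le in \<open>auto simp: p'_def\<close>)
  moreover have "agree_on (slab a b) p' c p c"
    by (auto simp: agree_on_def p'_def)
  ultimately show ?thesis by blast
qed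

lemma block_vector: "{i, j, k} \<subseteq> {- 1, 0, 1} \<Longrightarrow> m + vector [i, j, k] \<in> block (m - 1)"
  by (auto simp: block_def forall_3)

text \<open>Relative to the centre \<open>m\<close> of the block below \<open>u\<close>, the
  vertices other than \<open>u\<close> have heights -3 to 2, that is \<open>b - 5\<close> to
  \<open>b\<close>; this is the bound \<open>a + 5 \<le> b\<close>. As \<open>height m\<close> is
  odd, offsets with even sum carry circles and those with odd sum carry points.\<close>

lemma circles_below_meet:
  assumes pc: "point_circle_complex_on (slab a b) p c" and gen: "generic_on (slab a b) p c"
    and b: "a + 5 \<le> b" "odd b" and u: "height u = b + 1"
  shows "\<exists>x. \<forall>i. x \<in> c (u - axis i 1)"
proof -
  define m where "m = u - 1"
  have u_eq: "u = m + vector [1, 1, 1]" by (simp add: m_def vec_eq_iff forall_3)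
  have m: "height m = b - 2" using u unfolding u_eq by simp
  have inc: "p (m + vector [i, j, k]) \<in> c (m + vector [i', j', k'])"
    if adj: "adjacent (m + vector [i, j, k]) (m + vector [i', j', k'])" and "odd (i + j + k)"
      "i + j + k \<in> {- 3..2}" "i' + j' + k' \<in> {- 3..2}"
    for i j k i' j' k'
  proof (rule incident[OF pc _ _ _ _ adj])
    have "i' + j' + k' = i + j + k + 1 \<or> i' + j' + k' = i + j + k - 1"
      using adjacent_height[OF adj] unfolding height_add_vector by linarith
    then have "even (i' + j' + k')" using \<open>odd (i + j + k)\<close> by (elim disjE) simp_all
    then show "odd (height (m + vector [i', j', k']))" "even (height (m + vector [i, j, k]))"
      using \<open>odd (i + j + k)\<close> b(2) m by simp_all
    show "m + vector [i, j, k] \<in> slab a b" "m + vector [i', j', k'] \<in> slab a b"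
      using that(3,4) b(1) m by simp_all
  qed
  have circ: "c (m + vector [i, j, k]) \<in> mcircles"
    if "even (i + j + k)" "i + j + k \<in> {- 3..2}" for i j k
  proof (rule circle_in_mcircles[OF pc])
    show "m + vector [i, j, k] \<in> slab a b" "odd (height (m + vector [i, j, k]))"
      using that b m by simp_all
  qed
  have pne: "p (m + vector [i, j, k]) \<noteq> p (m + vector [i', j', k'])"
    if "odd (i + j + k)" "odd (i' + j' + k')" "i + j + k \<in> {- 3..2}" "i' + j' + k' \<in> {- 3..2}"
      "{i, j, k} \<subseteq> {- 1, 0, 1}" "{i', j', k'} \<subseteq> {- 1, 0, 1}" "(i, j, k) \<noteq> (i', j', k')"
    for i j k i' j' k'
  proof (rule generic_on_points[OF gen _ _ _ _ _ block_vector block_vector])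
    show "m + vector [i, j, k] \<in> slab a b" "m + vector [i', j', k'] \<in> slab a b"
      "even (height (m + vector [i, j, k]))" "even (height (m + vector [i', j', k']))"
      using that(1-4) b m by simp_all
    show "m + vector [i, j, k] \<noteq> m + vector [i', j', k']"
      using that(7) by (auto simp: vec_eq_iff forall_3)
  qed (fact that)+
  have cne: "c (m + vector [i, j, k]) \<noteq> c (m + vector [0, 0, 0])"
    if "even (i + j + k)" "i + j + k \<in> {- 3..2}" "{i, j, k} \<subseteq> {- 1, 0, 1}" "(i, j, k) \<noteq> (0, 0, 0)"
    for i j k
  proof (rule generic_on_circles[OF gen _ _ _ _ _ block_vector block_vector])
    show "m + vector [i, j, k] \<in> slab a b" "m + vector [0, 0, 0] \<in> slab a b"
      "odd (height (m + vector [i, j, k]))" "odd (height (m + vector [0, 0, 0]))"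
      using that(1,2) b m by simp_all
    show "m + vector [i, j, k] \<noteq> m + vector [0, 0, 0]"
      using that(4) by (auto simp: vec_eq_iff forall_3)
  qed (use that in auto)
  \<comment> \<open>The octahedron sits in the block with its vertices on the coordinate axes
    through \<open>m\<close>. The family \<open>C\<close> takes the third sign before the first,
    following the cyclic order of the edges.\<close>
  have "c (m + vector [1, 1, 0]) \<inter> c (m + vector [0, 1, 1]) \<inter> c (m + vector [1, 0, 1]) \<noteq> {}"
  proof (rule octahedron[where K = "c (m + vector [0, 0, 0])"
        and a = "\<lambda>i. p (m + vector [i, 0, 0])" and b = "\<lambda>j. p (m + vector [0, j, 0])"
        and c = "\<lambda>k. p (m + vector [0, 0, k])" and A = "\<lambda>i j. c (m + vector [i, j, 0])"
        and B = "\<lambda>j k. c (m + vector [0, j, k])" and C = "\<lambda>k i. c (m + vector [i, 0, k])"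
        and x = "\<lambda>i j k. p (m + vector [i, j, k])"])
    show "c (m + vector [0, 0, 0]) \<in> mcircles" by (rule circ) auto
    fix i :: int assume i: "i \<in> {- 1, 1}"
    note ai = adjacent_vector[OF i]
    have "p (m + vector [i, 0, 0]) \<in> c (m + vector [0, 0, 0])"
      by (rule inc[OF ai(1)]) (use i in auto)
    moreover have "p (m + vector [0, i, 0]) \<in> c (m + vector [0, 0, 0])"
      by (rule inc[OF ai(2)]) (use i in auto)
    moreover have "p (m + vector [0, 0, i]) \<in> c (m + vector [0, 0, 0])"
      by (rule inc[OF ai(3)]) (use i in auto)
    ultimately show "{p (m + vector [i, 0, 0]), p (m + vector [0, i, 0]), p (m + vector [0, 0, i])}
        \<subseteq> c (m + vector [0, 0, 0])" by blast
    fix j :: int assume j: "j \<in> {- 1, 1}"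
    note aj = adjacent_vector[OF j]
    show "p (m + vector [i, 0, 0]) \<noteq> p (m + vector [0, j, 0]) \<and>
        p (m + vector [0, i, 0]) \<noteq> p (m + vector [0, 0, j]) \<and>
        p (m + vector [0, 0, i]) \<noteq> p (m + vector [j, 0, 0])"
      by (intro conjI pne) (use i j in auto)
    have "c (m + vector [i, j, 0]) \<in> mcircles" "c (m + vector [i, j, 0]) \<noteq> c (m + vector [0, 0, 0])"
      by (rule circ cne; use i j in auto)+
    moreover have "p (m + vector [i, 0, 0]) \<in> c (m + vector [i, j, 0])"
      by (rule inc[OF adjacent_sym[OF aj(2)]]) (use i j in auto)
    moreover have "p (m + vector [0, j, 0]) \<in> c (m + vector [i, j, 0])"
      by (rule inc[OF adjacent_sym[OF ai(1)]]) (use i j in auto)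
    ultimately show "c (m + vector [i, j, 0]) \<in> mcircles - {c (m + vector [0, 0, 0])} \<and>
        {p (m + vector [i, 0, 0]), p (m + vector [0, j, 0])} \<subseteq> c (m + vector [i, j, 0])" by blast
    have "c (m + vector [0, i, j]) \<in> mcircles" "c (m + vector [0, i, j]) \<noteq> c (m + vector [0, 0, 0])"
      by (rule circ cne; use i j in auto)+
    moreover have "p (m + vector [0, i, 0]) \<in> c (m + vector [0, i, j])"
      by (rule inc[OF adjacent_sym[OF aj(3)]]) (use i j in auto)
    moreover have "p (m + vector [0, 0, j]) \<in> c (m + vector [0, i, j])"
      by (rule inc[OF adjacent_sym[OF ai(2)]]) (use i j in auto)
    ultimately show "c (m + vector [0, i, j]) \<in> mcircles - {c (m + vector [0, 0, 0])} \<and>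
        {p (m + vector [0, i, 0]), p (m + vector [0, 0, j])} \<subseteq> c (m + vector [0, i, j])" by blast
    have "c (m + vector [j, 0, i]) \<in> mcircles" "c (m + vector [j, 0, i]) \<noteq> c (m + vector [0, 0, 0])"
      by (rule circ cne; use i j in auto)+
    moreover have "p (m + vector [0, 0, i]) \<in> c (m + vector [j, 0, i])"
      by (rule inc[OF adjacent_sym[OF aj(1)]]) (use i j in auto)
    moreover have "p (m + vector [j, 0, 0]) \<in> c (m + vector [j, 0, i])"
      by (rule inc[OF adjacent_sym[OF ai(3)]]) (use i j in auto)
    ultimately show "c (m + vector [j, 0, i]) \<in> mcircles - {c (m + vector [0, 0, 0])} \<and>
        {p (m + vector [0, 0, i]), p (m + vector [j, 0, 0])} \<subseteq> c (m + vector [j, 0, i])" by blast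
    fix k :: int assume k: "k \<in> {- 1, 1}" and ijk: "(i, j, k) \<noteq> (1, 1, 1)"
    note ak = adjacent_vector[OF k]
    \<comment> \<open>Only the corner \<open>(1, 1, 1)\<close>, which is \<open>u\<close> itself,
      lies above the slab; the other seven points are already known.\<close>
    have le: "i + j + k \<le> 2" using i j k ijk by auto
    have "p (m + vector [i, j, k]) \<in> c (m + vector [i, j, 0])"
      by (rule inc[OF ak(3)]) (use i j k le in auto)
    moreover have "p (m + vector [i, j, k]) \<in> c (m + vector [0, j, k])"
      by (rule inc[OF ai(1)]) (use i j k le in auto)
    moreover have "p (m + vector [i, j, k]) \<in> c (m + vector [i, 0, k])"
      by (rule inc[OF aj(2)]) (use i j k le in auto)
    moreover have "p (m + vector [i, j, k]) \<noteq> p (m + vector [i, 0, 0])"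
      by (rule pne) (use i j k le in auto)
    moreover have "p (m + vector [i, j, k]) \<noteq> p (m + vector [0, j, 0])"
      by (rule pne) (use i j k le in auto)
    ultimately show "p (m + vector [i, j, k]) \<in> c (m + vector [i, j, 0]) \<inter> c (m + vector [0, j, k])
          \<inter> c (m + vector [i, 0, k]) \<and>
        p (m + vector [i, j, k]) \<notin> {p (m + vector [i, 0, 0]), p (m + vector [0, j, 0])}"
      by blast
  qed
  then obtain x where "x \<in> c (m + vector [1, 1, 0])" "x \<in> c (m + vector [0, 1, 1])" "x \<in> c (m + vector [1, 0, 1])"
    by blast
  moreover have "u - axis 1 1 = m + vector [0, 1, 1]" "u - axis 2 1 = m + vector [1, 0, 1]"
    "u - axis 3 1 = m + vector [1, 1, 0]"
    by (simp_all add: u_eq vec_eq_iff forall_3 axis_def)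
  ultimately show ?thesis by (auto simp: forall_3)
qed

section \<open>Existence and uniqueness\<close>

lemma uminus_slab: "uminus -` slab a b = slab (- b) (- a)"
  by auto

text \<open>Negation reverses heights but keeps their parity and adjacency, so points stay points
  and circles stay circles while up and down are exchanged.\<close>

lemma point_circle_complex_on_uminus:
  assumes "point_circle_complex_on D p c"
  shows "point_circle_complex_on (uminus -` D) (\<lambda>n. p (- n)) (\<lambda>n. c (- n))"
  by (rule point_circle_complex_onI)
    (use point_undefined[OF assms] circle_undefined[OF assms] circle_in_mcircles[OF assms]
      incident[OF assms] in auto)

lemma generic_on_uminus:
  assumes "generic_on D p c"
  shows "generic_on (uminus -` D) (\<lambda>n. p (- n)) (\<lambda>n. c (- n))"
  unfolding generic_on_def
proof (intro allI conjI inj_onI)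
  fix w n n'
  \<comment> \<open>The shift by 2 arises because negation turns the lowest corner \<open>w\<close>
    of a block into its highest one.\<close>
  have block: "- m \<in> block (- w - 2)" if "m \<in> block w" for m
  proof -
    have m: "w $ i \<le> m $ i \<and> m $ i \<le> w $ i + 2" for i using that by (simp add: block_def)
    have "- w $ i - 2 \<le> - m $ i \<and> - m $ i \<le> - w $ i - 2 + 2" for i using m[of i] by linarith
    then show ?thesis by (simp add: block_def)
  qed
  show "n = n'" if "n \<in> block w \<inter> uminus -` D \<inter> even_lattice" "n' \<in> block w \<inter> uminus -` D \<inter> even_lattice"
    "p (- n) = p (- n')"
    using generic_on_points[OF assms, of "- n" "- n'" "- w - 2"] that block by auto
  show "n = n'" if "n \<in> block w \<inter> uminus -` D \<inter> odd_lattice" "n' \<in> block w \<inter> uminus -` D \<inter> odd_lattice"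
    "c (- n) = c (- n')"
    using generic_on_circles[OF assms, of "- n" "- n'" "- w - 2"] that block by auto
qed

lemma agree_on_uminus:
  "agree_on D p c p' c' \<Longrightarrow>
    agree_on (uminus -` D) (\<lambda>n. p (- n)) (\<lambda>n. c (- n)) (\<lambda>n. p' (- n)) (\<lambda>n. c' (- n))"
  unfolding agree_on_def by auto

lemma agree_on_subset: "agree_on D p c p' c' \<Longrightarrow> D' \<subseteq> D \<Longrightarrow> agree_on D' p c p' c'"
  unfolding agree_on_def by blast

lemma agree_on_trans: "agree_on D p c p' c' \<Longrightarrow> agree_on D p' c' p'' c'' \<Longrightarrow> agree_on D p c p'' c''"
  unfolding agree_on_def by auto

lemma agree_on_refl [simp]: "agree_on D p c p c"
  unfolding agree_on_def by auto

lemma extend_up: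
  assumes "point_circle_complex_on (slab a b) p c" "generic_on (slab a b) p c"
    and "a \<le> b" "odd b \<Longrightarrow> a + 5 \<le> b"
  shows "\<exists>p' c'. point_circle_complex_on (slab a (b + 1)) p' c' \<and> agree_on (slab a b) p' c' p c"
proof (cases "even b")
  case True
  then show ?thesis using extend_up_odd assms by blast
next
  case False
  then show ?thesis
    using extend_up_even[OF assms(1,3)] circles_below_meet[OF assms(1,2)] assms(4) by blast
qed

lemma extend_down_reflected:
  assumes "\<exists>p' c'. point_circle_complex_on (slab (- b) (- a + 1)) p' c' \<and>
      agree_on (slab (- b) (- a)) p' c' (\<lambda>n. p (- n)) (\<lambda>n. c (- n))"
  shows "\<exists>p' c'. point_circle_complex_on (slab (a - 1) b) p' c' \<and> agree_on (slab a b) p' c' p c"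
proof -
  obtain p' c' where *: "point_circle_complex_on (slab (- b) (- a + 1)) p' c'"
    "agree_on (slab (- b) (- a)) p' c' (\<lambda>n. p (- n)) (\<lambda>n. c (- n))"
    using assms by blast
  have "point_circle_complex_on (slab (a - 1) b) (\<lambda>n. p' (- n)) (\<lambda>n. c' (- n))"
    using point_circle_complex_on_uminus[OF *(1)] by (simp add: uminus_slab)
  moreover have "agree_on (slab a b) (\<lambda>n. p' (- n)) (\<lambda>n. c' (- n)) p c"
    using agree_on_uminus[OF *(2)] by (simp add: uminus_slab)
  ultimately show ?thesis by blast
qed

lemma extend_down:
  assumes "point_circle_complex_on (slab a b) p c" "generic_on (slab a b) p c"
    and "a \<le> b" "odd a \<Longrightarrow> a + 5 \<le> b"
  shows "\<exists>p' c'. point_circle_complex_on (slab (a - 1) b) p' c' \<and> agree_on (slab a b) p' c' p c"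
  using point_circle_complex_on_uminus[OF assms(1)] generic_on_uminus[OF assms(2)] assms(3,4)
  by (intro extend_down_reflected extend_up) (auto simp: uminus_slab)

lemma extend_down_even:
  assumes "point_circle_complex_on (slab a b) p c" "a \<le> b" "odd a"
    and "\<And>u. height u = a - 1 \<Longrightarrow> \<exists>x. \<forall>i. x \<in> c (u + axis i 1)"
  shows "\<exists>p' c'. point_circle_complex_on (slab (a - 1) b) p' c' \<and> agree_on (slab a b) p' c' p c"
proof (intro extend_down_reflected extend_up_even)
  show "\<exists>x. \<forall>i. x \<in> c (- (u - axis i 1))" if "height u = - a + 1" for u
    using assms(4)[of "- u"] that by (simp add: algebra_simps)
qed (use point_circle_complex_on_uminus[OF assms(1)] assms(2,3) in \<open>auto simp: uminus_slab\<close>)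

text \<open>A circle is fixed by three points below it. A point is fixed as the second intersection
  of two distinct circles below it, whose first intersection lies two layers down; hence
  \<open>a < b\<close> when the new layer carries points.\<close>

lemma agree_up:
  assumes pc: "point_circle_complex_on UNIV p c" "generic_on UNIV p c"
    and pc': "point_circle_complex_on UNIV p' c'" "generic_on UNIV p' c'"
    and agree: "agree_on (slab a b) p c p' c'" and "a \<le> b" "odd b \<Longrightarrow> a < b"
  shows "agree_on (slab a (b + 1)) p c p' c'"
proof -
  have old: "p u = p' u" if "u \<in> slab a b" "even (height u)" for u
    using agree that unfolding agree_on_def by auto
  have old': "c v = c' v" if "v \<in> slab a b" "odd (height v)" for v
    using agree that unfolding agree_on_def by auto
  have "c v = c' v" if v: "height v = b + 1" "odd (height v)" for v
  proof -
    have "p' (v - axis i 1) = p (v - axis i 1)" for i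
      using old[of "v - axis i 1"] v assms(6) by simp
    then show ?thesis
      using generic_on_below[OF pc(2) UNIV_I v(2)] incident[OF pc(1)] incident[OF pc'(1), of "v - axis _ 1" v]
        circle_in_mcircles[OF pc(1)] circle_in_mcircles[OF pc'(1)] v(2)
      by (intro mcircle_unique_3[of "\<lambda>i. p (v - axis i 1)"]) auto
  qed
  moreover have "p u = p' u" if u: "height u = b + 1" "even (height u)" for u
  proof (rule ccontr)
    assume ne: "p u \<noteq> p' u"
    \<comment> \<open>\<open>q\<close> is the lower common neighbour of \<open>u - axis 1 1\<close>
      and \<open>u - axis 2 1\<close>, so their circles already meet in \<open>p q\<close>. Two
      candidates for \<open>u\<close> would give them three common points.\<close>
    define q where "q = u - axis 1 1 - axis 2 1"
    have a: "a < b" using assms(7) u by simp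
    have q: "p' q = p q" using old[of q] u a by (simp add: q_def)
    have c: "c' (u - axis i 1) = c (u - axis i 1)" for i
      using old'[of "u - axis i 1"] u assms(6) by simp
    have "q \<in> block (u - 2)" "u \<in> block (u - 2)" "u - axis i 1 \<in> block (u - 2)" for i
      by (auto simp: block_def q_def axis_def)
    note block = this
    have "q \<noteq> u" by (auto simp: q_def vec_eq_iff axis_def)
    then have "p u \<noteq> p q" "p' u \<noteq> p' q"
      using generic_on_points[OF pc(2), of u q "u - 2"] generic_on_points[OF pc'(2), of u q "u - 2"]
        block u by (auto simp: q_def)
    have "c (u - axis 1 1) = c (u - axis 2 1)"
    proof (rule mcircle_unique)
      show "{p u, p' u, p q} \<subseteq> c (u - axis 1 1)"
        using incident[OF pc(1), of u "u - axis 1 1"] incident[OF pc'(1), of u "u - axis 1 1"]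
          incident[OF pc(1), of q "u - axis 1 1"] u c by (auto simp: q_def)
      have "adjacent q (u - axis 2 1)"
        unfolding adjacent_def q_def by (intro exI[of _ 1]) simp
      then show "{p u, p' u, p q} \<subseteq> c (u - axis 2 1)"
        using incident[OF pc(1), of u "u - axis 2 1"] incident[OF pc'(1), of u "u - axis 2 1"]
          incident[OF pc(1), of q "u - axis 2 1"] u c by (auto simp: q_def)
    qed (use ne q \<open>p u \<noteq> p q\<close> \<open>p' u \<noteq> p' q\<close> u circle_in_mcircles[OF pc(1)] in auto)
    moreover have "u - axis 1 1 \<noteq> u - axis (2::3) 1" by (simp add: axis_eq_axis)
    ultimately show False
      using generic_on_circles[OF pc(2), of "u - axis 1 1" "u - axis 2 1" "u - 2"] block u by auto
  qed
  ultimately show ?thesis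
    using old old' unfolding agree_on_def by (metis (mono_tags) IntE mem_even_lattice mem_odd_lattice mem_slab zle_add1_eq_le order_le_less)
qed

text \<open>Each layer is determined by those between it and layer 0, so agreement spreads from
  layer 0 in both directions. One upward step, applied directly and after reflection, enlarges the
  symmetric slab.\<close>

lemma complex_unique:
  assumes pc: "point_circle_complex_on UNIV p c" "generic_on UNIV p c"
    and pc': "point_circle_complex_on UNIV p' c'" "generic_on UNIV p' c'"
    and agree: "\<And>u. u \<in> A2 0 \<Longrightarrow> p u = p' u"
  shows "p = p' \<and> c = c'"
proof -
  have *: "agree_on (slab (- int k) (int k)) p c p' c'" for k
  proof (induction k)
    case 0
    then show ?case using agree by (auto simp: agree_on_def)
  next
    case (Suc k)
    \<comment> \<open>A new layer of points occurs only for odd \<open>k\<close>, so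
      \<open>k\<close> is at least 1 and the slab has the two layers required.\<close>
    have k: "- int k < int k" if "odd k" using that by (cases k) auto
    have "agree_on (slab (- int k) (int k + 1)) p c p' c'"
      using agree_up[OF pc pc' Suc] k by simp
    note up = agree_on_uminus[OF this, unfolded uminus_slab]
    have "agree_on (slab (- (int k + 1)) (int k + 1)) (\<lambda>n. p (- n)) (\<lambda>n. c (- n)) (\<lambda>n. p' (- n)) (\<lambda>n. c' (- n))"
      using agree_up[OF point_circle_complex_on_uminus[OF pc(1), simplified] generic_on_uminus[OF pc(2), simplified]
        point_circle_complex_on_uminus[OF pc'(1), simplified] generic_on_uminus[OF pc'(2), simplified] up] by simp
    from agree_on_uminus[OF this] show ?case by (simp add: uminus_slab algebra_simps)
  qed
  have slab: "n \<in> slab (- int (nat \<bar>height n\<bar>)) (int (nat \<bar>height n\<bar>))" for n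
    by simp linarith
  \<comment> \<open>At odd vertices both maps are \<open>undefined\<close> by extensionality; this
    is what turns agreement into equality of functions.\<close>
  have "p u = p' u" for u
  proof (cases "even (height u)")
    case True
    then have "u \<in> even_lattice" by simp
    then show ?thesis using *[of "nat \<bar>height u\<bar>"] slab[of u] unfolding agree_on_def by blast
  qed (simp add: point_undefined[OF pc(1)] point_undefined[OF pc'(1)])
  moreover have "c v = c' v" for v
  proof (cases "odd (height v)")
    case True
    then have "v \<in> odd_lattice" by simp
    then show ?thesis using *[of "nat \<bar>height v\<bar>"] slab[of v] unfolding agree_on_def by blast
  qed (simp add: circle_undefined[OF pc(1)] circle_undefined[OF pc'(1)])
  ultimately show ?thesis by blast
qed

text \<open>The slab grows by one layer on either side at each stage. Genericity of the data is
  inherited by every finite continuation, which allows the next extension; the complex on the whole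
  lattice is the union of the stages.\<close>

lemma complex_exists:
  assumes data: "point_circle_complex_on (slab (- 2) 2) p0 c0" and gen: "generic_data (slab (- 2) 2) p0 c0"
  shows "\<exists>p c. point_circle_complex_on UNIV p c \<and> generic_on UNIV p c \<and> agree_on (slab (- 2) 2) p c p0 c0"
proof -
  define I where "I k = slab (- int k - 2) (int k + 2)" for k
  define P where "P k pc \<longleftrightarrow> point_circle_complex_on (I k) (fst pc) (snd pc) \<and>
    agree_on (slab (- 2) 2) (fst pc) (snd pc) p0 c0" for k and pc :: "(int^3 \<Rightarrow> mpoint) \<times> (int^3 \<Rightarrow> mpoint set)"
  define Q where "Q k pc pc' \<longleftrightarrow> agree_on (I k) (fst pc') (snd pc') (fst pc) (snd pc)"
    for k and pc pc' :: "(int^3 \<Rightarrow> mpoint) \<times> (int^3 \<Rightarrow> mpoint set)"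
  have generic: "generic_on (slab a b) p c"
    if "a \<le> - 2" "2 \<le> b" "point_circle_complex_on (slab a b) p c" "agree_on (slab (- 2) 2) p c p0 c0" for a b p c
  proof -
    have "slab (- 2) 2 \<subseteq> slab a b" using that by auto
    then show ?thesis using gen that unfolding generic_data_def by blast
  qed
  have "\<exists>s. \<forall>k. P k (s k) \<and> Q k (s k) (s (Suc k))"
  proof (rule dependent_nat_choice)
    show "\<exists>pc. P 0 pc" using data by (intro exI[of _ "(p0, c0)"]) (simp add: P_def I_def)
    fix pc k assume "P k pc"
    then have pc: "point_circle_complex_on (I k) (fst pc) (snd pc)" "agree_on (slab (- 2) 2) (fst pc) (snd pc) p0 c0"
      by (auto simp: P_def)
    \<comment> \<open>The octahedron theorem is invoked only for odd \<open>k\<close>. Then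
      \<open>k\<close> is at least 1 and stage \<open>k\<close> has at least seven layers, enough
      for the six it uses.\<close>
    have k: "0 < int k" if "odd (int k)" using that by (cases k) auto
    have "\<exists>p' c'. point_circle_complex_on (slab (- int k - 2) (int k + 2 + 1)) p' c' \<and>
        agree_on (slab (- int k - 2) (int k + 2)) p' c' (fst pc) (snd pc)"
      using pc k unfolding I_def by (intro extend_up generic) auto
    then obtain p1 c1 where 1: "point_circle_complex_on (slab (- int k - 2) (int k + 3)) p1 c1"
      "agree_on (I k) p1 c1 (fst pc) (snd pc)"
      unfolding I_def by (auto simp: add.assoc)
    have sub: "slab (- 2) 2 \<subseteq> I k" by (auto simp: I_def)
    have "agree_on (slab (- 2) 2) p1 c1 p0 c0"
      using agree_on_trans[OF agree_on_subset[OF 1(2) sub] pc(2)] .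
    then have "\<exists>p' c'. point_circle_complex_on (slab (- int k - 2 - 1) (int k + 3)) p' c' \<and>
        agree_on (slab (- int k - 2) (int k + 3)) p' c' p1 c1"
      using 1(1) k by (intro extend_down generic) auto
    moreover have "slab (- int k - 2 - 1) (int k + 3) = I (Suc k)" by (auto simp: I_def)
    ultimately obtain p2 c2 where 2: "point_circle_complex_on (I (Suc k)) p2 c2"
      "agree_on (slab (- int k - 2) (int k + 3)) p2 c2 p1 c1"
      by auto
    have "I k \<subseteq> slab (- int k - 2) (int k + 3)" by (auto simp: I_def)
    then have 3: "agree_on (I k) p2 c2 (fst pc) (snd pc)"
      using agree_on_trans[OF agree_on_subset[OF 2(2)] 1(2)] by blast
    have "agree_on (slab (- 2) 2) p2 c2 p0 c0"
      using agree_on_trans[OF agree_on_subset[OF 3 sub] pc(2)] .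
    then show "\<exists>pc'. P (Suc k) pc' \<and> Q k pc pc'"
      using 2(1) 3 by (intro exI[of _ "(p2, c2)"]) (simp add: P_def Q_def)
  qed
  then obtain s where s: "\<And>k. P k (s k)" "\<And>k. Q k (s k) (s (Suc k))" by blast
  have agree: "agree_on (I j) (fst (s k)) (snd (s k)) (fst (s j)) (snd (s j))" if "j \<le> k" for j k
    using that
  proof (induction k rule: dec_induct)
    case (step k)
    have "I j \<subseteq> I k" using step by (auto simp: I_def)
    then have "agree_on (I j) (fst (s (Suc k))) (snd (s (Suc k))) (fst (s k)) (snd (s k))"
      using s(2)[of k] agree_on_subset unfolding Q_def by blast
    then show ?case using step.IH agree_on_trans by blast
  qed simp
  define h where "h n = nat \<bar>height n\<bar>" for n
  \<comment> \<open>Each vertex takes its value from the stage indexed by its absolute height, which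
    already contains it; later stages do not change this value.\<close>
  define p c where "p u = fst (s (h u)) u" and "c v = snd (s (h v)) v" for u v
  have I_mono: "n \<in> I k" if "h n \<le> k" for n k
    using that by (auto simp: I_def h_def)
  have p_eq: "p u = fst (s k) u" if "even (height u)" "h u \<le> k" for u k
    using agree[OF that(2)] I_mono[of u "h u"] that(1) unfolding agree_on_def p_def by auto
  have c_eq: "c v = snd (s k) v" if "odd (height v)" "h v \<le> k" for v k
    using agree[OF that(2)] I_mono[of v "h v"] that(1) unfolding agree_on_def c_def by auto
  have sc: "point_circle_complex_on (I k) (fst (s k)) (snd (s k))" for k
    using s(1) unfolding P_def by blast
  have "point_circle_complex_on UNIV p c"
  proof (rule point_circle_complex_onI)
    fix u v assume uv: "even (height u)" "odd (height v)" "adjacent u v"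
    define k where "k = max (h u) (h v)"
    have "p u = fst (s k) u" "c v = snd (s k) v" "u \<in> I k" "v \<in> I k"
      using p_eq c_eq I_mono uv unfolding k_def by simp_all
    then show "p u \<in> c v" using incident[OF sc] uv by simp
  next
    show "c v \<in> mcircles" if "odd (height v)" for v
      using circle_in_mcircles[OF sc[of "h v"] I_mono] that by (simp add: c_def)
  qed (auto simp: p_def c_def point_undefined[OF sc] circle_undefined[OF sc])
  moreover have "generic_on UNIV p c"
    unfolding generic_on_def
  proof (intro allI conjI inj_onI)
    fix w n n'
    define k where "k = max (h n) (h n')"
    have k: "n \<in> I k" "n' \<in> I k" "h n \<le> k" "h n' \<le> k"
      using I_mono unfolding k_def by simp_all
    have g: "generic_on (I k) (fst (s k)) (snd (s k))"
      using generic[of "- int k - 2" "int k + 2"] s(1)[of k] unfolding P_def I_def by simp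
    show "n = n'" if "n \<in> block w \<inter> UNIV \<inter> even_lattice" "n' \<in> block w \<inter> UNIV \<inter> even_lattice" "p n = p n'"
      using generic_on_points[OF g k(1,2)] p_eq k(3,4) that by auto
    show "n = n'" if "n \<in> block w \<inter> UNIV \<inter> odd_lattice" "n' \<in> block w \<inter> UNIV \<inter> odd_lattice" "c n = c n'"
      using generic_on_circles[OF g k(1,2)] c_eq k(3,4) that by auto
  qed
  moreover have "agree_on (slab (- 2) 2) p c p0 c0"
  proof -
    have "agree_on (slab (- 2) 2) p c (fst (s 2)) (snd (s 2))"
      using p_eq[of _ 2] c_eq[of _ 2] unfolding agree_on_def h_def by auto
    then show ?thesis using s(1)[of 2] agree_on_trans unfolding P_def by blast
  qed
  ultimately show ?thesis by blast
qed

text \<open>The layers 1 and -1 produced by continuation must carry the prescribed circles, because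
  three distinct points span only one circle. The concurrence assumptions then yield the layers 2
  and -2, which completes a set of Cauchy data.\<close>

lemma complex_from_points_exists:
  assumes gen: "generic_data (A2 0) p0 c0"
    and up: "\<forall>v \<in> A2 1. c0 v = circle_through {p0 (v - std_basis i) | i. True}"
    and down: "\<forall>v \<in> A2 (- 1). c0 v = circle_through {p0 (v + std_basis i) | i. True}"
    and meet_up: "\<forall>u \<in> A2 2. \<exists>x. \<forall>i. x \<in> c0 (u - std_basis i)"
    and meet_down: "\<forall>u \<in> A2 (- 2). \<exists>x. \<forall>i. x \<in> c0 (u + std_basis i)"
  shows "\<exists>p c. point_circle_complex_on UNIV p c \<and> generic_on UNIV p c \<and> (\<forall>u \<in> A2 0. p u = p0 u)"
proof -
  have agree_0: "agree_on (A2 0) p c p' c' \<longleftrightarrow> (\<forall>u \<in> A2 0. p u = p' u)" for p c p' c'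
    by (auto simp: agree_on_def)
  have generic: "generic_on (slab a b) p c"
    if "a \<le> 0" "0 \<le> b" "point_circle_complex_on (slab a b) p c" "\<forall>u \<in> A2 0. p u = p0 u" for a b p c
  proof -
    have "A2 0 \<subseteq> slab a b" using that by auto
    then show ?thesis using gen that agree_0 unfolding generic_data_def by blast
  qed
  have agree_p: "\<forall>u \<in> A2 0. p' u = p0 u"
    if "agree_on (slab a b) p' c' p c" "\<forall>u \<in> A2 0. p u = p0 u" "a \<le> 0" "0 \<le> b" for a b p c p' c'
  proof -
    have "A2 0 \<subseteq> slab a b" using that by auto
    then show ?thesis using agree_on_subset[OF that(1)] that(2) agree_0[of p' c' p c] by simp
  qed
  \<comment> \<open>Layer 0 has no odd vertices, so the extensional circle map on it is
    \<open>undefined\<close> everywhere.\<close>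
  define p1 c1 where "p1 u = (if u \<in> A2 0 then p0 u else undefined)" and "c1 v = (undefined :: mpoint set)"
    for u v :: "int^3"
  have 1: "point_circle_complex_on (slab 0 0) p1 c1" "\<forall>u \<in> A2 0. p1 u = p0 u"
    by (auto intro!: point_circle_complex_onI simp: p1_def c1_def)
  obtain p2 c2 where 2: "point_circle_complex_on (slab 0 1) p2 c2" "agree_on (slab 0 0) p2 c2 p1 c1"
    using extend_up[OF 1(1) generic[OF _ _ 1]] by auto
  have p2: "\<forall>u \<in> A2 0. p2 u = p0 u" using agree_p[OF 2(2) 1(2)] by simp
  obtain p3 c3 where 3: "point_circle_complex_on (slab (- 1) 1) p3 c3" "agree_on (slab 0 1) p3 c3 p2 c2"
    using extend_down[OF 2(1) generic[OF _ _ 2(1) p2]] by auto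
  have p3: "\<forall>u \<in> A2 0. p3 u = p0 u" using agree_p[OF 3(2) p2] by simp
  have g3: "generic_on (slab (- 1) 1) p3 c3" using generic[OF _ _ 3(1) p3] by simp
  have c3_up: "c3 v = c0 v" if v: "height v = 1" for v
  proof -
    have "circle_through {p3 (v - axis i 1) | i. True} = c3 v"
      using v generic_on_below[OF g3, of v] circle_in_mcircles[OF 3(1), of v]
      by (intro circle_through_3 incident[OF 3(1)]) auto
    then show ?thesis using up v p3 by simp
  qed
  have c3_down: "c3 v = c0 v" if v: "height v = - 1" for v
  proof -
    \<comment> \<open>The statement about lower neighbours is applied to the reflected complex at
      \<open>- v\<close>, whose lower neighbours are the reflected upper neighbours of
      \<open>v\<close>.\<close>
    have "inj (\<lambda>i. p3 (- (- v - axis i 1)))"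
      using v by (intro generic_on_below[OF generic_on_uminus[OF g3]]) (auto simp: uminus_slab)
    then have "inj (\<lambda>i. p3 (v + axis i 1))" by (simp add: add.commute)
    then have "circle_through {p3 (v + axis i 1) | i. True} = c3 v"
      using v circle_in_mcircles[OF 3(1), of v]
      by (intro circle_through_3 incident[OF 3(1)]) auto
    then show ?thesis using down v p3 by simp
  qed
  have "\<exists>p' c'. point_circle_complex_on (slab (- 1) (1 + 1)) p' c' \<and> agree_on (slab (- 1) 1) p' c' p3 c3"
    using 3(1) meet_up c3_up by (intro extend_up_even) auto
  then obtain p4 c4 where 4: "point_circle_complex_on (slab (- 1) 2) p4 c4" "agree_on (slab (- 1) 1) p4 c4 p3 c3"
    by auto
  have p4: "\<forall>u \<in> A2 0. p4 u = p0 u" using agree_p[OF 4(2) p3] by simp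
  have c4: "c4 v = c0 v" if "height v = - 1" for v
    using 4(2) c3_down that unfolding agree_on_def by simp
  have "\<exists>p' c'. point_circle_complex_on (slab (- 1 - 1) 2) p' c' \<and> agree_on (slab (- 1) 2) p' c' p4 c4"
    using 4(1) meet_down c4 by (intro extend_down_even) auto
  then obtain p5 c5 where 5: "point_circle_complex_on (slab (- 2) 2) p5 c5" "agree_on (slab (- 1) 2) p5 c5 p4 c4"
    by auto
  have p5: "\<forall>u \<in> A2 0. p5 u = p0 u" using agree_p[OF 5(2) p4] by simp
  \<comment> \<open>Every continuation of the five layers also continues the points of layer 0, so
    their genericity carries over.\<close>
  have "generic_data (slab (- 2) 2) p5 c5"
    unfolding generic_data_def
  proof (intro allI impI, elim conjE)
    fix a b p c
    assume *: "slab (- 2) 2 \<subseteq> slab a b" "point_circle_complex_on (slab a b) p c" "agree_on (slab (- 2) 2) p c p5 c5"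
    have "A2 0 \<subseteq> slab (- 2) 2" by auto
    then have "A2 0 \<subseteq> slab a b" "agree_on (A2 0) p c p0 c0"
      using * agree_p[OF *(3) p5] agree_0 by auto
    then show "generic_on (slab a b) p c" using gen *(2) unfolding generic_data_def by blast
  qed
  then obtain p c where "point_circle_complex_on UNIV p c" "generic_on UNIV p c" "agree_on (slab (- 2) 2) p c p5 c5"
    using complex_exists[OF 5(1)] by blast
  then show ?thesis using agree_p[OF _ p5] by force
qed

theorem theorem5p2:
  shows
   "(\<forall>p c p' c'.
       fundamental_point_circle_complex p c \<and> generic_on UNIV p c \<and>
       fundamental_point_circle_complex p' c' \<and> generic_on UNIV p' c' \<and>
       agree_on (slab (-2) 2) p c p' c'
       \<longrightarrow> p = p' \<and> c = c')
    \<and>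
    (\<forall>p0 c0.
       point_circle_complex_on (slab (-2) 2) p0 c0 \<and> generic_data (slab (-2) 2) p0 c0
       \<longrightarrow> (\<exists>!pc. case pc of (p, c) \<Rightarrow>
             fundamental_point_circle_complex p c \<and> generic_on UNIV p c \<and>
             agree_on (slab (-2) 2) p c p0 c0))
    \<and>
    (\<forall>p0 c0.
       generic_data (A2 0) p0 c0 \<and>
       (\<forall>v \<in> A2 1. c0 v = circle_through {p0 (v - std_basis i) | i. True}) \<and>
       (\<forall>v \<in> A2 (-1). c0 v = circle_through {p0 (v + std_basis i) | i. True}) \<and>
       (\<forall>u \<in> A2 2. \<exists>x. \<forall>i. x \<in> c0 (u - std_basis i)) \<and>
       (\<forall>u \<in> A2 (-2). \<exists>x. \<forall>i. x \<in> c0 (u + std_basis i))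
       \<longrightarrow> (\<exists>!pc. case pc of (p, c) \<Rightarrow>
             fundamental_point_circle_complex p c \<and> generic_on UNIV p c \<and>
             (\<forall>u \<in> A2 0. p u = p0 u)))"
proof (intro conjI allI impI)
  fix p c p' c'
  assume "fundamental_point_circle_complex p c \<and> generic_on UNIV p c \<and>
    fundamental_point_circle_complex p' c' \<and> generic_on UNIV p' c' \<and>
    agree_on (slab (-2) 2) p c p' c'"
  then have "p = p' \<and> c = c'"
    by (intro complex_unique) (auto simp: fundamental_point_circle_complex_def agree_on_def)
  then show "p = p'" "c = c'" by auto
next
  fix p0 c0
  assume "point_circle_complex_on (slab (-2) 2) p0 c0 \<and> generic_data (slab (-2) 2) p0 c0"
  then obtain p c where pc: "point_circle_complex_on UNIV p c" "generic_on UNIV p c" "agree_on (slab (-2) 2) p c p0 c0"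
    using complex_exists by blast
  show "\<exists>!pc. case pc of (p, c) \<Rightarrow> fundamental_point_circle_complex p c \<and> generic_on UNIV p c \<and>
    agree_on (slab (-2) 2) p c p0 c0"
  proof (rule ex1I[of _ "(p, c)"])
    fix pc' assume "case pc' of (p, c) \<Rightarrow> fundamental_point_circle_complex p c \<and> generic_on UNIV p c \<and>
      agree_on (slab (-2) 2) p c p0 c0"
    then obtain p' c' where pc': "pc' = (p', c')" "point_circle_complex_on UNIV p' c'" "generic_on UNIV p' c'"
      "agree_on (slab (-2) 2) p' c' p0 c0"
      by (cases pc') (auto simp: fundamental_point_circle_complex_def)
    \<comment> \<open>Both complexes are compared with the data on layer 0, from which agreement
      propagates.\<close>
    have "p' u = p u" if "u \<in> A2 0" for u
      using pc(3) pc'(4) that by (simp add: agree_on_def)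
    then show "pc' = (p, c)"
      using complex_unique[OF pc'(2,3) pc(1,2)] pc'(1) by simp
  qed (use pc in \<open>simp add: fundamental_point_circle_complex_def\<close>)
next
  fix p0 c0
  assume "generic_data (A2 0) p0 c0 \<and>
       (\<forall>v \<in> A2 1. c0 v = circle_through {p0 (v - std_basis i) | i. True}) \<and>
       (\<forall>v \<in> A2 (-1). c0 v = circle_through {p0 (v + std_basis i) | i. True}) \<and>
       (\<forall>u \<in> A2 2. \<exists>x. \<forall>i. x \<in> c0 (u - std_basis i)) \<and>
       (\<forall>u \<in> A2 (-2). \<exists>x. \<forall>i. x \<in> c0 (u + std_basis i))"
  then obtain p c where pc: "point_circle_complex_on UNIV p c" "generic_on UNIV p c" "\<forall>u \<in> A2 0. p u = p0 u"
    using complex_from_points_exists[of p0 c0] by blast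
  show "\<exists>!pc. case pc of (p, c) \<Rightarrow> fundamental_point_circle_complex p c \<and> generic_on UNIV p c \<and>
    (\<forall>u \<in> A2 0. p u = p0 u)"
  proof (rule ex1I[of _ "(p, c)"])
    fix pc' assume "case pc' of (p, c) \<Rightarrow> fundamental_point_circle_complex p c \<and> generic_on UNIV p c \<and>
      (\<forall>u \<in> A2 0. p u = p0 u)"
    then obtain p' c' where pc': "pc' = (p', c')" "point_circle_complex_on UNIV p' c'" "generic_on UNIV p' c'"
      "\<forall>u \<in> A2 0. p' u = p0 u"
      by (cases pc') (auto simp: fundamental_point_circle_complex_def)
    then show "pc' = (p, c)"
      using complex_unique[OF pc'(2,3) pc(1,2)] pc(3) by simp
  qed (use pc in \<open>simp add: fundamental_point_circle_complex_def\<close>)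
qed

end
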